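(* For every $\lambda\in[0,1]$, $\alpha\in(0,1]$ and $\Gamma\in(0,1)$, the asymptotic competition complexity of the VCG auction with supply-to-demand ratio $\alpha$, over the class $\mathcal F_{(\lambda\text{-Reg})}$ of $\lambda$-regular distributions, with target approximation ratio $\Gamma$, satisfies $$\mathrm{CC}_{(\infty)}(\alpha,\mathcal F_{(\lambda\text{-Reg})},\Gamma)=\left(\alpha\left(\frac{\lambda\,\Gamma}{\alpha}(1-\lambda)^{\frac{1-\lambda}{\lambda}}+1\right)^{\frac1\lambda}-1\right)^{+}\cdot\mathbf 1\left\{\alpha\ge(1-\lambda)^{\frac1\lambda}\right\}.$$ In the special cases $\lambda=0$ (MHR distributions, $\mathcal F_{\mathrm{MHR}}$) and $\lambda=1$ (regular distributions, $\mathcal F_{\mathrm{Reg}}$) this reads $$\mathrm{CC}_{(\infty)}(\alpha,\mathcal F_{\mathrm{MHR}},\Gamma)=\left(\alpha\, e^{\frac{\Gamma}{e\alpha}}-1\right)^{+}\cdot\mathbf 1\left\{\alpha\ge\tfrac1e\right\},\qquad \mathrm{CC}_{(\infty)}(\alpha,\mathcal F_{\mathrm{Reg}},\Gamma)=(\Gamma+\alpha-1)^{+}.$$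
   Context: Notation: $(x)^+=\max\{x,0\}$. Expressions at $\lambda=0$ or $\lambda=1$ are read as limits (e.g. at $\lambda=0$: $(1-\lambda)^{1/\lambda}=1/e$ and the general formula becomes the displayed MHR formula; at $\lambda=1$: $(1-\lambda)^{(1-\lambda)/\lambda}=1$ and $(1-\lambda)^{1/\lambda}=0$). Distributions. A valuation distribution $F$ is a probability distribution on $[0,\infty)$; $F$ also denotes its CDF with the convention $F(v)=\Pr_{x\sim F}[x<v]$. Its support is an interval on which it has a density $f$, except that an atom at the right endpoint of the support is allowed (in particular point masses are allowed). It is assumed that some price $p\in\mathrm{supp}(F)$ maximizes $p\,(1-F(p))$ over $p\ge0$; such a maximizer is called a monopoly reserve $r^*$. For $\lambda\in[0,1]$, $F$ is $\lambda$-regular if $\lambda v-\frac{1-F(v)}{f(v)}$ is non-decreasing in $v$ on the support (excluding the possible atom at its right endpoint); $\lambda=1$ is regularity and $\lambda=0$ is the monotone hazard rate (MHR) condition. $\mathcal F_{(\lambda\text{-Reg})}$ is the class of $\lambda$-regular distributions. Mechanisms. In an $m$-unit, $N$-buyer market ($m\le N$) the buyers have unit demand and values drawn i.i.d. from $F$; all bid truthfully. The VCG auction gives one unit to each of the $m$ highest-valued buyers (ties broken arbitrarily) and each winner pays the $(m+1)$-th highest value (taken to be $0$ if $N=m$). $\mathrm{RevVCG}_{m:N}(F)$ is its expected total payment. The Bayesian-optimal mechanism with monopoly reserve $r^*$ gives one unit to each of the $m$ highest-valued buyers whose value is at least $r^*$; each winner pays the maximum of $r^*$ and the $(m+1)$-th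 highest value ($0$ if $N=m$). $\mathrm{RevOPT}_{m:N}(F)$ is its expected total payment. Competition complexity. $\mathrm{CC}(m,n,\mathcal F,\Gamma)=\min\{k\in\mathbb Z_{\ge0}:\ \forall F\in\mathcal F,\ \mathrm{RevVCG}_{m:n+k}(F)\ge\Gamma\cdot\mathrm{RevOPT}_{m:n}(F)\}$ (and $\infty$ if no such $k$ exists). The asymptotic competition complexity is $$\mathrm{CC}_{(\infty)}(\alpha,\mathcal F,\Gamma)=\lim_{n\to\infty}\frac{\mathrm{CC}(\lceil\alpha n\rceil,n,\mathcal F,\Gamma)}{n}.$$ *)

theory Defs
  imports "HOL-Probability.Probability" "HOL-Library.Extended_Nat" "HOL-Real_Asymp.Real_Asymp"
begin

subsection \<open>Valuation distributions\<close>

text \<open>The convention is F(v) = Pr[x < v], so \<^term>\<open>1 - cdf_lt F p\<close> is the probability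
  that a buyer accepts the price p; it differs from \<^const>\<open>cdf\<close> at atoms.\<close>

definition cdf_lt :: "real measure \<Rightarrow> real \<Rightarrow> real" where
  "cdf_lt F v = measure F {..<v}"

definition supp :: "real measure \<Rightarrow> real set" where
  "supp F = {x. \<forall>U. open U \<longrightarrow> x \<in> U \<longrightarrow> 0 < measure F U}"

text \<open>The support without its right endpoint (if it has one); empty for a point mass.\<close>

definition supp_below :: "real measure \<Rightarrow> real set" where
  "supp_below F = {v \<in> supp F. \<exists>w \<in> supp F. v < w}"

definition density_below :: "real measure \<Rightarrow> (real \<Rightarrow> real) \<Rightarrow> bool" where
  "density_below F f \<longleftrightarrow>
     f \<in> borel_measurable borel \<and> (\<forall>v. 0 \<le> f v) \<and>
     (\<forall>A \<in> sets borel. A \<subseteq> supp_below F \<longrightarrow>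
        emeasure F A = (\<integral>\<^sup>+v\<in>A. ennreal (f v) \<partial>lborel))"

definition is_monopoly_reserve :: "real measure \<Rightarrow> real \<Rightarrow> bool" where
  "is_monopoly_reserve F r \<longleftrightarrow>
     r \<in> supp F \<and> (\<forall>p\<ge>0. p * (1 - cdf_lt F p) \<le> r * (1 - cdf_lt F r))"

definition valuation_distribution :: "real measure \<Rightarrow> bool" where
  "valuation_distribution F \<longleftrightarrow>
     prob_space F \<and> sets F = sets borel \<and> (AE v in F. 0 \<le> v) \<and>
     is_interval (supp F) \<and> (\<exists>f. density_below F f) \<and> (\<exists>r. is_monopoly_reserve F r)"

text \<open>A density is only determined almost everywhere, so regularity asks for some version of it.
  The quotient is taken in \<^typ>\<open>ereal\<close>: on \<^const>\<open>supp_below\<close> its numerator is positive, so where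
  the density vanishes (as for the density 2v on [0,1] at v = 0) the quotient is infinite
  instead of 0.\<close>

definition lambda_regular :: "real \<Rightarrow> real measure \<Rightarrow> bool" where
  "lambda_regular lam F \<longleftrightarrow>
     (\<exists>f. density_below F f \<and>
        mono_on (supp_below F)
          (\<lambda>v. ereal (lam * v) - ereal (1 - cdf_lt F v) / ereal (f v)))"

definition lambda_Reg :: "real \<Rightarrow> real measure set" where
  "lambda_Reg lam = {F. valuation_distribution F \<and> lambda_regular lam F}"

abbreviation "MHR \<equiv> lambda_Reg 0"

abbreviation "Reg \<equiv> lambda_Reg 1"


subsection \<open>Mechanisms\<close>

text \<open>Buyers are the numbers below N and x is the profile of values.\<close>

definition kth_highest :: "nat \<Rightarrow> nat \<Rightarrow> (nat \<Rightarrow> real) \<Rightarrow> real" where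
  "kth_highest k N x =
     (if 1 \<le> k \<and> k \<le> N then sort (map x [0..<N]) ! (N - k) else 0)"

text \<open>The m highest-valued buyers, with ties broken in favour of the smaller index.\<close>

definition top_buyers :: "nat \<Rightarrow> nat \<Rightarrow> (nat \<Rightarrow> real) \<Rightarrow> nat set" where
  "top_buyers m N x =
     {i. i < N \<and> card {j. j < N \<and> (x i < x j \<or> x j = x i \<and> j < i)} < m}"

definition payment_VCG :: "nat \<Rightarrow> nat \<Rightarrow> (nat \<Rightarrow> real) \<Rightarrow> real" where
  "payment_VCG m N x = (\<Sum>i\<in>top_buyers m N x. kth_highest (m + 1) N x)"

definition payment_OPT :: "real \<Rightarrow> nat \<Rightarrow> nat \<Rightarrow> (nat \<Rightarrow> real) \<Rightarrow> real" where
  "payment_OPT r m N x =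
     (\<Sum>i\<in>{i \<in> top_buyers m N x. r \<le> x i}. max r (kth_highest (m + 1) N x))"

definition Rev_VCG :: "nat \<Rightarrow> nat \<Rightarrow> real measure \<Rightarrow> ennreal" where
  "Rev_VCG m N F = (\<integral>\<^sup>+x. ennreal (payment_VCG m N x) \<partial>(\<Pi>\<^sub>M i\<in>{..<N}. F))"

text \<open>A monopoly reserve need not be unique, but for regular distributions the revenue does not
  depend on which one is used.\<close>

definition monopoly_reserve :: "real measure \<Rightarrow> real" where
  "monopoly_reserve F = (SOME r. is_monopoly_reserve F r)"

definition Rev_OPT :: "nat \<Rightarrow> nat \<Rightarrow> real measure \<Rightarrow> ennreal" where
  "Rev_OPT m N F =
     (\<integral>\<^sup>+x. ennreal (payment_OPT (monopoly_reserve F) m N x) \<partial>(\<Pi>\<^sub>M i\<in>{..<N}. F))"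


subsection \<open>Competition complexity\<close>

text \<open>The infimum of the empty set in \<^typ>\<open>enat\<close> is infinity.\<close>

definition CC :: "nat \<Rightarrow> nat \<Rightarrow> real measure set \<Rightarrow> real \<Rightarrow> enat" where
  "CC m n \<F> \<Gamma> =
     Inf {enat k | k. \<forall>F\<in>\<F>. Rev_VCG m (n + k) F \<ge> ennreal \<Gamma> * Rev_OPT m n F}"

definition CC_ratio :: "real \<Rightarrow> real measure set \<Rightarrow> real \<Rightarrow> nat \<Rightarrow> ereal" where
  "CC_ratio \<alpha> \<F> \<Gamma> n =
     ereal_of_enat (CC (nat \<lceil>\<alpha> * real n\<rceil>) n \<F> \<Gamma>) / ereal (real n)"

definition CC_infty :: "real \<Rightarrow> real measure set \<Rightarrow> real \<Rightarrow> ereal" where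
  "CC_infty \<alpha> \<F> \<Gamma> = lim (CC_ratio \<alpha> \<F> \<Gamma>)"


subsection \<open>The expressions of the closed form, extended to lam = 0 and lam = 1 by limits\<close>

text \<open>\<open>(1 - lam)\<close> to the power \<open>1 / lam\<close>; no case is needed at 1, where \<^term>\<open>0 powr 1 = (0::real)\<close>.\<close>

definition threshold :: "real \<Rightarrow> real" where
  "threshold lam = (if lam = 0 then exp (- 1) else (1 - lam) powr (1 / lam))"

text \<open>\<open>(1 - lam)\<close> to the power \<open>(1 - lam) / lam\<close>; the case at 1 is needed because
  \<^term>\<open>0 powr 0 = (0::real)\<close>.\<close>

definition reg_factor :: "real \<Rightarrow> real" where
  "reg_factor lam =
     (if lam = 0 then exp (- 1) else if lam = 1 then 1
      else (1 - lam) powr ((1 - lam) / lam))"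

definition growth :: "real \<Rightarrow> real \<Rightarrow> real \<Rightarrow> real" where
  "growth lam \<alpha> \<Gamma> =
     (if lam = 0 then \<alpha> * exp (\<Gamma> / (exp 1 * \<alpha>))
      else \<alpha> * (lam * \<Gamma> / \<alpha> * reg_factor lam + 1) powr (1 / lam))"

lemma threshold_tendsto_0: "(threshold \<longlongrightarrow> threshold 0) (at_right 0)"
proof -
  have "((\<lambda>l::real. (1 - l) powr (1 / l)) \<longlongrightarrow> exp (- 1)) (at_right 0)"
    by real_asymp
  moreover have "\<forall>\<^sub>F l in at_right 0. (1 - l) powr (1 / l) = threshold l"
    by (auto simp: eventually_at_filter threshold_def)
  ultimately show ?thesis
    by (rule Lim_transform_eventually[THEN tendsto_eq_rhs]) (simp add: threshold_def)
qed

lemma threshold_tendsto_1: "(threshold \<longlongrightarrow> threshold 1) (at_left 1)"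
proof -
  have "((\<lambda>l::real. (1 - l) powr (1 / l)) \<longlongrightarrow> 0) (at_left 1)"
    by real_asymp
  moreover have "\<forall>\<^sub>F l in at_left 1. (1 - l) powr (1 / l) = threshold l"
    using eventually_at_left_real[of 0 "1::real"]
    by (auto simp: threshold_def elim!: eventually_mono)
  ultimately show ?thesis
    by (rule Lim_transform_eventually[THEN tendsto_eq_rhs]) (simp add: threshold_def)
qed

lemma reg_factor_tendsto_0: "(reg_factor \<longlongrightarrow> reg_factor 0) (at_right 0)"
proof -
  have "((\<lambda>l::real. (1 - l) powr ((1 - l) / l)) \<longlongrightarrow> exp (- 1)) (at_right 0)"
    by real_asymp
  moreover have "\<forall>\<^sub>F l in at_right 0. (1 - l) powr ((1 - l) / l) = reg_factor l"
    using eventually_at_right_real[of 0 "1::real"]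
    by (auto simp: reg_factor_def elim!: eventually_mono)
  ultimately show ?thesis
    by (rule Lim_transform_eventually[THEN tendsto_eq_rhs]) (simp add: reg_factor_def)
qed

lemma reg_factor_tendsto_1: "(reg_factor \<longlongrightarrow> reg_factor 1) (at_left 1)"
proof -
  have "((\<lambda>l::real. (1 - l) powr ((1 - l) / l)) \<longlongrightarrow> 1) (at_left 1)"
    by real_asymp
  moreover have "\<forall>\<^sub>F l in at_left 1. (1 - l) powr ((1 - l) / l) = reg_factor l"
    using eventually_at_left_real[of 0 "1::real"]
    by (auto simp: reg_factor_def elim!: eventually_mono)
  ultimately show ?thesis
    by (rule Lim_transform_eventually[THEN tendsto_eq_rhs]) (simp add: reg_factor_def)
qed

lemma growth_tendsto_0:
  assumes "0 < \<alpha>" "0 < \<Gamma>"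
  shows "((\<lambda>l. growth l \<alpha> \<Gamma>) \<longlongrightarrow> growth 0 \<alpha> \<Gamma>) (at_right 0)"
proof -
  have "((\<lambda>l::real. \<alpha> * (l * \<Gamma> / \<alpha> * ((1 - l) powr ((1 - l) / l)) + 1) powr (1 / l))
          \<longlongrightarrow> \<alpha> * exp (\<Gamma> / (exp 1 * \<alpha>))) (at_right 0)"
    using assms by (real_asymp simp: field_simps exp_minus)
  moreover have "\<forall>\<^sub>F l in at_right 0.
      \<alpha> * (l * \<Gamma> / \<alpha> * ((1 - l) powr ((1 - l) / l)) + 1) powr (1 / l) = growth l \<alpha> \<Gamma>"
    using eventually_at_right_real[of 0 "1::real"]
    by (auto simp: growth_def reg_factor_def elim!: eventually_mono)
  ultimately show ?thesis
    by (rule Lim_transform_eventually[THEN tendsto_eq_rhs]) (simp add: growth_def)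
qed

end

theory Submission
  imports Defs
begin

text \<open>
  Let \<open>S p\<close> be the probability of accepting the price \<open>p\<close>. A distribution is \<open>lam\<close>-regular only if
  \<open>L (S p)\<close> is convex in \<open>p\<close>, where \<open>L\<close> is the quantile function of the generalized Pareto distribution.
  With \<open>m = \<alpha> n\<close> units and \<open>N = g n\<close> buyers, concentration of the number of buyers above a price shows
  that VCG earns about \<open>m p\<close>, where \<open>S p = \<alpha> / g\<close>. By Lagrangian duality the optimal mechanism earns at
  most \<open>c m + n B\<close> whenever \<open>(x - c) S x \<le> B\<close> for all prices \<open>x\<close>; for \<open>c = 0\<close> this is the monopoly revenue
  \<open>n r S r\<close>. Convexity and \<open>L (S 0) = 0\<close> give \<open>p / r \<ge> L (S p) / L (S r)\<close>, so the ratio of the two revenues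
  is at least \<open>\<alpha> L (\<alpha> / g) / (q L q)\<close> with \<open>q = S r\<close>. The denominator is maximal at the threshold, where
  it equals the regularity factor, and solving for \<open>g\<close> yields the formula. Truncated generalized Pareto
  distributions make the estimate tight.
\<close>

subsection \<open>Payments for a fixed profile of values\<close>

text \<open>\<open>CC\<close> asks for one number of extra buyers that serves every distribution of
  the class, so all errors must be independent of the distribution. Order statistics are therefore
  translated into counts of buyers above a price, and Hoeffding's inequality controls these
  uniformly. Optimal revenue has no such uniform tail control, since regular distributions may be
  heavy-tailed; hence its upper bound is an exact duality bound, free of probabilistic error. A
  positive surcharge is used when demand at the reserve exceeds supply: the dual bound is then
  matched by a price accepted with probability at least \<open>a = m / n\<close>, so nothing is
  lost. Losses only come from reserves whose acceptance probability \<open>q\<close> is below that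
  of the VCG price. This explains the indicator: if \<alpha> is below the threshold,
  \<open>q * L q\<close> increases on that range and no extra buyers are needed asymptotically. The
  tight examples need \<theta> strictly between the threshold and \<alpha>: above the threshold the
  atom becomes the reserve, and below \<alpha> supply does not bind at it.\<close>

lemma count_le_iff_kth_highest:
  assumes "1 \<le> k" "k \<le> N"
  shows "v \<le> kth_highest k N x \<longleftrightarrow> k \<le> card {j. j < N \<and> v \<le> x j}"
proof -
  define xs where "xs = sort (map x [0..<N])"
  have len: "length xs = N" and srt: "sorted xs" by (simp_all add: xs_def)
  have "card {j. j < N \<and> v \<le> x j} = length (filter (\<lambda>y. v \<le> y) (map x [0..<N]))"
    unfolding length_filter_conv_card by (intro arg_cong[where f = card]) auto
  also have "\<dots> = length (filter (\<lambda>y. v \<le> y) xs)"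
    by (simp add: xs_def filter_sort)
  also have "\<dots> = card {i. i < N \<and> v \<le> xs ! i}"
    unfolding length_filter_conv_card len by simp
  finally have card: "card {j. j < N \<and> v \<le> x j} = card {i. i < N \<and> v \<le> xs ! i}" .
  have kth: "kth_highest k N x = xs ! (N - k)" using assms by (simp add: kth_highest_def xs_def)
  show ?thesis
  proof
    assume "v \<le> kth_highest k N x"
    then have "{N - k..<N} \<subseteq> {i. i < N \<and> v \<le> xs ! i}"
      using sorted_nth_mono[OF srt, of "N - k"] len kth by fastforce
    then have "card {N - k..<N} \<le> card {i. i < N \<and> v \<le> xs ! i}"
      by (intro card_mono) auto
    with assms card show "k \<le> card {j. j < N \<and> v \<le> x j}" by simp
  next
    assume k: "k \<le> card {j. j < N \<and> v \<le> x j}"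
    show "v \<le> kth_highest k N x"
    proof (rule ccontr)
      assume "\<not> v \<le> kth_highest k N x"
      then have less: "xs ! (N - k) < v" using kth by simp
      have "{i. i < N \<and> v \<le> xs ! i} \<subseteq> {N - k<..<N}"
      proof
        fix i assume i: "i \<in> {i. i < N \<and> v \<le> xs ! i}"
        show "i \<in> {N - k<..<N}"
        proof (rule ccontr)
          assume "i \<notin> {N - k<..<N}"
          then have "i \<le> N - k" using i by auto
          then have "xs ! i \<le> xs ! (N - k)"
            using sorted_nth_mono[OF srt] len assms by simp
          with less i show False by simp
        qed
      qed
      then have "card {i. i < N \<and> v \<le> xs ! i} \<le> card {N - k<..<N}"
        by (intro card_mono) auto
      with k card assms show False by simp
    qed
  qed
qed

text \<open>Ordering by value and then by index is total, so the number of buyers ahead is an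
  injection of the N buyers into \<open>{..<N}\<close>, hence a bijection, and exactly m buyers have
  rank below m.\<close>

lemma card_top_buyers:
  assumes "m \<le> N"
  shows "card (top_buyers m N x) = m"
proof -
  define before where "before i = {j. j < N \<and> (x i < x j \<or> x j = x i \<and> j < i)}" for i
  define rank where "rank i = card (before i)" for i
  have fin: "finite (before i)" for i by (auto simp: before_def)
  have strict: "rank j < rank i" if "j \<in> before i" for i j
  proof -
    have "before j \<subset> before i" using that by (auto simp: before_def)
    then show ?thesis unfolding rank_def by (intro psubset_card_mono fin)
  qed
  have total: "i \<in> before j \<or> j \<in> before i" if "i < N" "j < N" "i \<noteq> j" for i j
    using that by (auto simp: before_def)
  have inj: "inj_on rank {..<N}"
    by (rule inj_onI) (metis strict total lessThan_iff less_irrefl)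
  have rank_less: "rank i < N" if "i < N" for i
  proof -
    have "before i \<subseteq> {..<N} - {i}" by (auto simp: before_def)
    then have "rank i \<le> card ({..<N} - {i})" unfolding rank_def by (intro card_mono) auto
    also have "\<dots> < N" using that by simp
    finally show ?thesis .
  qed
  have img: "rank ` {..<N} = {..<N}"
    by (rule endo_inj_surj) (use inj rank_less in auto)
  have "rank ` top_buyers m N x = {..<m}"
  proof
    show "rank ` top_buyers m N x \<subseteq> {..<m}"
      by (auto simp: top_buyers_def rank_def before_def)
    show "{..<m} \<subseteq> rank ` top_buyers m N x"
    proof
      fix k assume "k \<in> {..<m}"
      then have "k \<in> rank ` {..<N}" "k < m" using img assms by auto
      then show "k \<in> rank ` top_buyers m N x"
        by (auto simp: top_buyers_def rank_def before_def)
    qed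
  qed
  moreover have "inj_on rank (top_buyers m N x)"
    by (rule inj_on_subset[OF inj]) (auto simp: top_buyers_def)
  ultimately show ?thesis using card_image by fastforce
qed

lemma finite_top_buyers [simp]: "finite (top_buyers m N x)"
  by (simp add: top_buyers_def)

lemma payment_VCG_eq: "m \<le> N \<Longrightarrow> payment_VCG m N x = real m * kth_highest (m + 1) N x"
  by (simp add: payment_VCG_def card_top_buyers)

lemma kth_highest_nonneg:
  assumes "\<And>j. j < N \<Longrightarrow> 0 \<le> x j"
  shows "0 \<le> kth_highest k N x"
proof (cases "1 \<le> k \<and> k \<le> N")
  case True
  have "{j. j < N \<and> 0 \<le> x j} = {..<N}" using assms by auto
  with True show ?thesis by (subst count_le_iff_kth_highest) auto
qed (auto simp: kth_highest_def)

text \<open>A winner pays at most the price that the other buyers set for him; that price does not depend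
  on his own value.\<close>

lemma winner_price_bounds:
  assumes nonneg: "\<And>j. j < N \<Longrightarrow> 0 \<le> x j" and m: "1 \<le> m" "m \<le> N"
    and i: "i \<in> top_buyers m N x"
  shows "kth_highest (m + 1) N x \<le> kth_highest m N (x(i := 0))"
    and "kth_highest m N (x(i := 0)) \<le> x i"
proof -
  have iN: "i < N" using i by (simp add: top_buyers_def)
  have nonneg': "0 \<le> (x(i := 0)) j" if "j < N" for j using that nonneg by simp
  show "kth_highest (m + 1) N x \<le> kth_highest m N (x(i := 0))"
  proof (cases "m + 1 \<le> N")
    case True
    let ?v = "kth_highest (m + 1) N x"
    have "m + 1 \<le> card {j. j < N \<and> ?v \<le> x j}"
      using count_le_iff_kth_highest[of "m + 1" N ?v x] True by simp
    also have "\<dots> \<le> card (insert i {j. j < N \<and> ?v \<le> (x(i := 0)) j})"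
      by (intro card_mono) auto
    also have "\<dots> \<le> Suc (card {j. j < N \<and> ?v \<le> (x(i := 0)) j})"
      by (rule card_insert_le_m1) auto
    finally show ?thesis
      using count_le_iff_kth_highest[of m N ?v "x(i := 0)"] m by simp
  next
    case False
    then have "kth_highest (m + 1) N x = 0" by (simp add: kth_highest_def)
    then show ?thesis using kth_highest_nonneg[of N "x(i := 0)" m] nonneg' by simp
  qed
  show "kth_highest m N (x(i := 0)) \<le> x i"
  proof (rule ccontr)
    let ?w = "kth_highest m N (x(i := 0))"
    assume "\<not> ?w \<le> x i"
    then have w: "x i < ?w" "0 < ?w" using nonneg[OF iN] by auto
    have "m \<le> card {j. j < N \<and> ?w \<le> (x(i := 0)) j}"
      using count_le_iff_kth_highest[of m N ?w "x(i := 0)"] m by simp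
    \<comment> \<open>\<open>?w\<close> is positive, so buyer i, whose value was reset to 0, is not
      counted; the m counted buyers all strictly outbid him, and he could not have won.\<close>
    also have "\<dots> \<le> card {j. j < N \<and> (x i < x j \<or> x j = x i \<and> j < i)}"
      using w by (intro card_mono) (auto split: if_splits)
    finally show False using i by (simp add: top_buyers_def)
  qed
qed

text \<open>A winner's price P is at most \<open>c + max 0 (P - c)\<close>. At most m winners
  contribute the c, and the non-negative remainders may be summed over all buyers. In the resulting
  sum buyer i simply faces a take-it-or-leave-it price set by the others.\<close>

lemma payment_OPT_upper:
  assumes nonneg: "\<And>j. j < N \<Longrightarrow> 0 \<le> x j" and m: "1 \<le> m" "m \<le> N" and c: "0 \<le> c"
  shows "payment_OPT r m N x \<le> c * real m +
    (\<Sum>i<N. let P = max r (kth_highest m N (x(i := 0))) in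
       if P \<le> x i then max 0 (P - c) else 0)"
proof -
  define P where "P i = max r (kth_highest m N (x(i := 0)))" for i
  let ?W = "{i \<in> top_buyers m N x. r \<le> x i}"
  have W: "finite ?W" "card ?W \<le> m" "?W \<subseteq> {..<N}"
    using card_mono[of "top_buyers m N x" ?W] card_top_buyers[OF m(2), of x]
    by (auto simp: top_buyers_def)
  have "payment_OPT r m N x \<le> (\<Sum>i\<in>?W. c + (if P i \<le> x i then max 0 (P i - c) else 0))"
    unfolding payment_OPT_def
  proof (rule sum_mono)
    fix i assume i: "i \<in> ?W"
    then have "max r (kth_highest (m + 1) N x) \<le> P i" "P i \<le> x i"
      using winner_price_bounds[of N x m i] nonneg m by (auto simp: P_def)
    then show "max r (kth_highest (m + 1) N x) \<le> c + (if P i \<le> x i then max 0 (P i - c) else 0)"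
      by (simp only: if_True)
  qed
  also have "\<dots> = c * real (card ?W) + (\<Sum>i\<in>?W. if P i \<le> x i then max 0 (P i - c) else 0)"
    by (simp add: sum.distrib)
  also have "\<dots> \<le> c * real m + (\<Sum>i<N. if P i \<le> x i then max 0 (P i - c) else 0)"
    using W c by (intro add_mono mult_left_mono sum_mono2) auto
  finally show ?thesis unfolding P_def Let_def .
qed

text \<open>Either everyone at or above the reserve wins, or someone there is turned away, and then
  all m winners rank ahead of him and reach the reserve too.\<close>

lemma payment_OPT_lower:
  assumes m: "m \<le> N" and r: "0 \<le> r" and K: "K \<le> m" "K \<le> card {j. j < N \<and> r \<le> x j}"
  shows "r * real K \<le> payment_OPT r m N x"
proof -
  let ?A = "{j. j < N \<and> r \<le> x j}"
  let ?T = "top_buyers m N x"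
  let ?W = "{i \<in> ?T. r \<le> x i}"
  have "K \<le> card ?W"
  proof (cases "?A \<subseteq> ?T")
    case True
    then have "?W = ?A" by (auto simp: top_buyers_def)
    with K show ?thesis by simp
  next
    case False
    then obtain j where j: "j < N" "r \<le> x j" "j \<notin> ?T" by auto
    let ?before = "\<lambda>i. {j. j < N \<and> (x i < x j \<or> x j = x i \<and> j < i)}"
    have "r \<le> x i" if "i \<in> ?T" for i
    proof (rule ccontr)
      assume "\<not> r \<le> x i"
      then have "?before j \<subseteq> ?before i" using j by auto
      then have "card (?before j) \<le> card (?before i)" by (intro card_mono) auto
      with j that show False by (simp add: top_buyers_def)
    qed
    then have "?W = ?T" by auto
    with K m show ?thesis by (simp add: card_top_buyers)
  qed
  then have "r * real K \<le> r * real (card ?W)" using r by (intro mult_left_mono) auto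
  also have "\<dots> = (\<Sum>i\<in>?W. r)" by simp
  also have "\<dots> \<le> payment_OPT r m N x"
    unfolding payment_OPT_def by (intro sum_mono) auto
  finally show ?thesis .
qed

subsection \<open>Concentration and revenue bounds\<close>

lemma count_eq_sum:
  fixes N :: nat and x :: "nat \<Rightarrow> real"
  shows "real (card {j. j < N \<and> v \<le> x j}) = (\<Sum>j<N. indicator {v..} (x j))"
proof -
  have "(\<Sum>j<N. indicator {v..} (x j)) = (\<Sum>j\<in>{j. j < N \<and> v \<le> x j}. (1::real))"
    by (intro sum.mono_neutral_cong_right) (auto simp: indicator_def)
  then show ?thesis by simp
qed

lemma measurable_kth_highest:
  assumes "sets F = sets (borel :: real measure)"
  shows "kth_highest k N \<in> borel_measurable (PiM {..<N} (\<lambda>_. F))"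
proof (cases "1 \<le> k \<and> k \<le> N")
  case True
  show ?thesis
  proof (rule borel_measurableI_ge)
    fix v
    have [measurable]: "(\<lambda>x. x j) \<in> borel_measurable (PiM {..<N} (\<lambda>_. F))" if "j < N" for j
      using that by (subst measurable_cong_sets[OF refl assms, symmetric])
        (auto intro: measurable_component_singleton)
    have meas: "(\<lambda>x. \<Sum>j<N. indicator {v..} (x j) :: real) \<in> borel_measurable (PiM {..<N} (\<lambda>_. F))"
      by (intro borel_measurable_sum) simp
    have "{x \<in> space (PiM {..<N} (\<lambda>_. F)). v \<le> kth_highest k N x} =
      {x \<in> space (PiM {..<N} (\<lambda>_. F)). real k \<le> (\<Sum>j<N. indicator {v..} (x j))}"
      using True by (simp add: count_le_iff_kth_highest flip: count_eq_sum)
    also have "\<dots> \<in> sets (PiM {..<N} (\<lambda>_. F))" using meas by measurable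
    finally show "{x \<in> space (PiM {..<N} (\<lambda>_. F)). v \<le> kth_highest k N x} \<in> sets (PiM {..<N} (\<lambda>_. F))" .
  qed
next
  case False
  then have "kth_highest k N = (\<lambda>_. 0)" by (auto simp: kth_highest_def fun_eq_iff)
  then show ?thesis by simp
qed

text \<open>Kept free of densities and regularity, so that the truncated Pareto measure can be
  plugged in directly as well.\<close>

locale iid_bids = prob_space F for F :: "real measure" +
  assumes sets_F: "sets F = sets borel"
begin

abbreviation profiles :: "nat \<Rightarrow> (nat \<Rightarrow> real) measure" where
  "profiles N \<equiv> PiM {..<N} (\<lambda>_. F)"

lemma space_F [simp]: "space F = UNIV"
  using sets_eq_imp_space_eq[OF sets_F] by simp

lemma prob_space_profiles: "prob_space (profiles N)"
  by (intro prob_space_PiM prob_space_axioms)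

lemma measurable_bid:
  assumes "j < N"
  shows "(\<lambda>x. x j) \<in> borel_measurable (profiles N)"
  using assms by (subst measurable_cong_sets[OF refl sets_F, symmetric])
    (auto intro: measurable_component_singleton)

lemma measurable_count [measurable]:
  "(\<lambda>x. real (card {j. j < N \<and> v \<le> x j})) \<in> borel_measurable (profiles N)"
proof -
  note measurable_bid[measurable]
  show ?thesis unfolding count_eq_sum by (intro borel_measurable_sum) simp
qed

lemma AE_all_bids:
  assumes "AE v in F. P v"
  shows "AE x in profiles N. \<forall>j<N. P (x j)"
proof -
  have "AE x in profiles N. \<forall>j\<in>{..<N}. P (x j)"
    by (intro AE_finite_allI AE_PiM_component prob_space_axioms assms) auto
  then show ?thesis by (rule eventually_mono) auto
qed

text \<open>Hoeffding's inequality for the indicators of \<open>{v..}\<close>. The bound depends on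
  N and \<delta> only, which yields estimates uniform in F.\<close>

lemma
  assumes "0 < N" "0 \<le> \<delta>"
  shows count_upper_tail:
      "measure (profiles N) {x \<in> space (profiles N). real N * (prob {v..} + \<delta>) \<le> real (card {j. j < N \<and> v \<le> x j})}
        \<le> exp (- 2 * real N * \<delta>\<^sup>2)" (is ?upper)
    and count_lower_tail:
      "measure (profiles N) {x \<in> space (profiles N). real (card {j. j < N \<and> v \<le> x j}) \<le> real N * (prob {v..} - \<delta>)}
        \<le> exp (- 2 * real N * \<delta>\<^sup>2)" (is ?lower)
proof -
  interpret P: prob_space "profiles N" by (rule prob_space_profiles)
  define X where "X = (\<lambda>i (x :: nat \<Rightarrow> real). indicator {v..} (x i) :: real)"
  \<comment> \<open>Independence of the coordinates amounts to the joint law being the product of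
    the marginals; restriction to \<open>{..<N}\<close> is the identity on the product
    space.\<close>
  have "P.indep_vars (\<lambda>_. F) (\<lambda>i x. x i) {..<N}"
  proof (subst P.indep_vars_iff_distr_eq_PiM')
    have "distr (profiles N) (profiles N) (\<lambda>x. restrict x {..<N}) = profiles N"
      by (rule trans[OF distr_cong[OF refl refl] distr_id]) (auto simp: space_PiM)
    also have "\<dots> = PiM {..<N} (\<lambda>i. distr (profiles N) F (\<lambda>x. x i))"
      by (intro PiM_cong refl distr_PiM_component[symmetric] prob_space_axioms) auto
    finally show "distr (profiles N) (profiles N) (\<lambda>x. \<lambda>i\<in>{..<N}. x i) = \<dots>" .
  qed (use assms in auto)
  then have "P.indep_vars (\<lambda>_. borel) (\<lambda>i x. indicator {v..} (x i) :: real) {..<N}"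
    by (rule P.indep_vars_compose2) (simp add: measurable_cong_sets[OF sets_F refl])
  then have indep: "P.indep_vars (\<lambda>_. borel) X {..<N}" by (simp add: X_def)
  have expect: "P.expectation (X i) = prob {v..}" if "i < N" for i
  proof -
    have "P.expectation (X i) = integral\<^sup>L (distr (profiles N) F (\<lambda>x. x i)) (indicator {v..})"
      unfolding X_def using that
      by (subst integral_distr) (auto simp: sets_F intro!: measurable_component_singleton borel_measurable_indicator)
    also have "distr (profiles N) F (\<lambda>x. x i) = F"
      using that by (intro distr_PiM_component prob_space_axioms) auto
    finally show ?thesis by (simp add: sets_F)
  qed
  interpret H: Hoeffding_ineq "profiles N" "{..<N}" X "\<lambda>_. 0" "\<lambda>_. 1" "\<Sum>i<N. P.expectation (X i)"
  proof unfold_locales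
    show "P.indep_vars (\<lambda>_. borel) X {..<N}" by (rule indep)
    show "AE x in profiles N. X i x \<in> {0..1}" for i by (simp add: X_def indicator_def)
  qed auto
  have sum: "(\<Sum>i<N. P.expectation (X i)) = real N * prob {v..}" by (simp add: expect)
  have exponent: "- 2 * (real N * \<delta>)\<^sup>2 / (\<Sum>i<N. (1 - 0)\<^sup>2) = - 2 * real N * \<delta>\<^sup>2"
    using assms by (simp add: power2_eq_square)
  have X: "(\<Sum>i<N. X i x) = real (card {j. j < N \<and> v \<le> x j})" for x
    by (simp add: X_def count_eq_sum)
  show ?upper ?lower
    using H.Hoeffding_ineq_ge[of "real N * \<delta>"] H.Hoeffding_ineq_le[of "real N * \<delta>"] assms
    unfolding exponent X sum by (simp_all add: algebra_simps)
qed

text \<open>Demand at p exceeds supply by a margin \<delta>, so it is very likely that all m units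
  are sold at p or more. No bound on the values is required.\<close>

lemma Rev_VCG_lower:
  assumes N: "0 < N" and \<delta>: "0 \<le> \<delta>" and p: "0 \<le> p" and m: "m < N"
    and demand: "real m / real N + \<delta> \<le> prob {p..}"
  shows "ennreal (real m * p * (1 - exp (- 2 * real N * \<delta>\<^sup>2))) \<le> Rev_VCG m N F"
proof -
  interpret P: prob_space "profiles N" by (rule prob_space_profiles)
  \<comment> \<open>The inequality is strict because the price is the value of rank m + 1: a further
    buyer beyond the m winners must reach p.\<close>
  define A where "A = {x \<in> space (profiles N). real m < real (card {j. j < N \<and> p \<le> x j})}"
  have A [measurable]: "A \<in> sets (profiles N)" unfolding A_def by measurable
  have "real m \<le> real N * (prob {p..} - \<delta>)"
    using demand N by (simp add: field_simps)
  then have "measure (profiles N) {x \<in> space (profiles N). real (card {j. j < N \<and> p \<le> x j}) \<le> real m} \<le> exp (- 2 * real N * \<delta>\<^sup>2)"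
    by (intro order_trans[OF P.finite_measure_mono count_lower_tail[OF N \<delta>, of p]]) auto
  also have "{x \<in> space (profiles N). real (card {j. j < N \<and> p \<le> x j}) \<le> real m} = space (profiles N) - A"
    by (auto simp: A_def)
  finally have "1 - exp (- 2 * real N * \<delta>\<^sup>2) \<le> measure (profiles N) A"
    by (simp add: P.prob_compl)
  then have "ennreal (real m * p * (1 - exp (- 2 * real N * \<delta>\<^sup>2))) \<le> ennreal (real m * p * measure (profiles N) A)"
    using p by (intro ennreal_leI mult_left_mono) auto
  also have "\<dots> = (\<integral>\<^sup>+x. ennreal (real m * p) * indicator A x \<partial>profiles N)"
    using p by (simp add: nn_integral_cmult_indicator ennreal_mult P.emeasure_eq_measure)
  also have "\<dots> \<le> Rev_VCG m N F"
    unfolding Rev_VCG_def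
  proof (rule nn_integral_mono)
    fix x
    have "p \<le> kth_highest (m + 1) N x" if "x \<in> A"
      using that m by (subst count_le_iff_kth_highest) (auto simp: A_def)
    then show "ennreal (real m * p) * indicator A x \<le> ennreal (payment_VCG m N x)"
      using m by (auto simp: payment_VCG_eq indicator_def intro!: ennreal_leI mult_left_mono)
  qed
  finally show ?thesis .
qed

text \<open>If demand at p falls short of supply by \<delta>, the price exceeds p only on an
  unlikely event, where the almost sure bound H on the values is charged instead.\<close>

lemma Rev_VCG_upper:
  assumes N: "0 < N" "m \<le> N" and \<delta>: "0 \<le> \<delta>" and p: "0 \<le> p" and H: "0 \<le> H" "AE v in F. v \<le> H"
    and demand: "prob {p..} + \<delta> \<le> real m / real N"
  shows "Rev_VCG m N F \<le> ennreal (real m * (p + H * exp (- 2 * real N * \<delta>\<^sup>2)))"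
proof -
  interpret P: prob_space "profiles N" by (rule prob_space_profiles)
  define A where "A = {x \<in> space (profiles N). real m \<le> real (card {j. j < N \<and> p \<le> x j})}"
  have A [measurable]: "A \<in> sets (profiles N)" unfolding A_def by measurable
  have "real N * (prob {p..} + \<delta>) \<le> real m"
    using demand N by (simp add: field_simps)
  then have A_le: "measure (profiles N) A \<le> exp (- 2 * real N * \<delta>\<^sup>2)"
    unfolding A_def by (intro order_trans[OF P.finite_measure_mono count_upper_tail[OF N(1) \<delta>, of p]]) auto
  have "Rev_VCG m N F \<le> (\<integral>\<^sup>+x. ennreal (real m * p) + ennreal (real m * H) * indicator A x \<partial>profiles N)"
    unfolding Rev_VCG_def
  proof (rule nn_integral_mono_AE, use AE_all_bids[OF H(2), of N] AE_space in eventually_elim)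
    case (elim x)
    let ?k = "kth_highest (m + 1) N x"
    have "?k \<le> p + H * indicator A x"
    proof (cases "?k \<le> p \<or> \<not> m + 1 \<le> N")
      case True
      then show ?thesis using p H(1) by (auto simp: kth_highest_def indicator_def)
    next
      case False
      \<comment> \<open>Here the price is above p, so the event A occurs; some bid is at least the
        price, so H bounds it.\<close>
      then have "m + 1 \<le> card {j. j < N \<and> p \<le> x j}" "1 \<le> card {j. j < N \<and> ?k \<le> x j}"
        using count_le_iff_kth_highest[of "m + 1" N p x] count_le_iff_kth_highest[of "m + 1" N ?k x] by auto
      moreover from this(2) obtain j where "j < N" "?k \<le> x j"
        by (metis (mono_tags, lifting) card.empty empty_Collect_eq not_one_le_zero)
      ultimately show ?thesis using elim p by (fastforce simp: A_def)
    qed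
    then have "real m * ?k \<le> real m * p + real m * H * indicator A x"
      by (metis mult_left_mono of_nat_0_le_iff distrib_left mult.assoc)
    then have "ennreal (real m * ?k) \<le> ennreal (real m * p + real m * H * indicator A x)"
      by (rule ennreal_leI)
    also have "\<dots> = ennreal (real m * p) + ennreal (real m * H * indicator A x)"
      using p H(1) by (intro ennreal_plus) auto
    finally have "ennreal (real m * ?k) \<le> ennreal (real m * p) + ennreal (real m * H * indicator A x)" .
    then show ?case using N p H(1) by (auto simp: payment_VCG_eq indicator_def split: if_splits)
  qed
  also have "\<dots> = ennreal (real m * p) + ennreal (real m * H) * ennreal (measure (profiles N) A)"
    by (simp add: nn_integral_add nn_integral_cmult_indicator P.emeasure_eq_measure P.emeasure_space_1 P.prob_space)
  also have "\<dots> = ennreal (real m * p + real m * H * measure (profiles N) A)"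
    using p H(1) by (simp add: ennreal_mult)
  also have "\<dots> \<le> ennreal (real m * (p + H * exp (- 2 * real N * \<delta>\<^sup>2)))"
    using A_le H(1) by (intro ennreal_leI) (auto simp: distrib_left mult.assoc intro!: mult_left_mono)
  finally show ?thesis .
qed

text \<open>With high probability at least K units are sold, each at the reserve or more; K is any
  integer within supply and a margin below expected demand.\<close>

lemma Rev_OPT_lower:
  assumes N: "0 < N" "m \<le> N" and \<delta>: "0 \<le> \<delta>" and r: "0 \<le> monopoly_reserve F"
    and K: "K \<le> m" "real K \<le> real N * (prob {monopoly_reserve F..} - \<delta>)"
  shows "ennreal (monopoly_reserve F * real K * (1 - exp (- 2 * real N * \<delta>\<^sup>2))) \<le> Rev_OPT m N F"
proof -
  interpret P: prob_space "profiles N" by (rule prob_space_profiles)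
  let ?r = "monopoly_reserve F"
  define A where "A = {x \<in> space (profiles N). real K < real (card {j. j < N \<and> ?r \<le> x j})}"
  have A [measurable]: "A \<in> sets (profiles N)" unfolding A_def by measurable
  have "measure (profiles N) {x \<in> space (profiles N). real (card {j. j < N \<and> ?r \<le> x j}) \<le> real K} \<le> exp (- 2 * real N * \<delta>\<^sup>2)"
    using K by (intro order_trans[OF P.finite_measure_mono count_lower_tail[OF N(1) \<delta>, of ?r]]) auto
  also have "{x \<in> space (profiles N). real (card {j. j < N \<and> ?r \<le> x j}) \<le> real K} = space (profiles N) - A"
    by (auto simp: A_def)
  finally have "1 - exp (- 2 * real N * \<delta>\<^sup>2) \<le> measure (profiles N) A"
    by (simp add: P.prob_compl)
  then have "ennreal (?r * real K * (1 - exp (- 2 * real N * \<delta>\<^sup>2))) \<le> ennreal (?r * real K * measure (profiles N) A)"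
    using r by (intro ennreal_leI mult_left_mono) auto
  also have "\<dots> = (\<integral>\<^sup>+x. ennreal (?r * real K) * indicator A x \<partial>profiles N)"
    using r by (simp add: nn_integral_cmult_indicator ennreal_mult P.emeasure_eq_measure)
  also have "\<dots> \<le> Rev_OPT m N F"
    unfolding Rev_OPT_def
  proof (rule nn_integral_mono)
    fix x
    have "?r * real K \<le> payment_OPT ?r m N x" if "x \<in> A"
      using that N r K by (intro payment_OPT_lower) (auto simp: A_def)
    then show "ennreal (?r * real K) * indicator A x \<le> ennreal (payment_OPT ?r m N x)"
      by (auto simp: indicator_def intro!: ennreal_leI)
  qed
  finally show ?thesis .
qed

text \<open>Weak duality: a surcharge \<open>c\<close> per unit removes the supply constraint, and then every buyer faces
  a price that is independent of his own value.\<close>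

lemma Rev_OPT_upper:
  assumes N: "1 \<le> m" "m \<le> N" and pos: "AE v in F. 0 \<le> v" and c: "0 \<le> c" and B: "0 \<le> B"
    and rev: "\<And>p. c \<le> p \<Longrightarrow> (p - c) * prob {p..} \<le> B"
  shows "Rev_OPT m N F \<le> ennreal (c * real m + real N * B)"
proof -
  interpret P: prob_space "profiles N" by (rule prob_space_profiles)
  interpret PS: product_sigma_finite "\<lambda>_::nat. F"
    by (unfold product_sigma_finite_def) (simp add: sigma_finite_measure_axioms)
  let ?r = "monopoly_reserve F"
  define price where "price i x = max ?r (kth_highest m N (x(i := 0)))" for i x
  define g where "g i x = (if price i x \<le> x i then max 0 (price i x - c) else 0)" for i x
  have upd: "(\<lambda>x. x(i := 0)) \<in> measurable (profiles N) (profiles N)" if "i < N" for i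
    using that by (intro measurable_fun_upd[where J = "{..<N}"])
      (auto simp: insert_absorb)
  have price [measurable]: "price i \<in> borel_measurable (profiles N)" if "i < N" for i
    using measurable_compose[OF upd[OF that] measurable_kth_highest[OF sets_F, of m N]]
    unfolding price_def by simp
  have g [measurable]: "g i \<in> borel_measurable (profiles N)" if "i < N" for i
    using price[OF that] measurable_bid[OF that] unfolding g_def by measurable
  have g_le: "(\<integral>\<^sup>+x. ennreal (g i x) \<partial>profiles N) \<le> ennreal B" if i: "i < N" for i
  proof -
    let ?J = "{..<N} - {i}"
    interpret PJ: prob_space "PiM ?J (\<lambda>_. F)" by (intro prob_space_PiM prob_space_axioms)
    have ins: "insert i ?J = {..<N}" using i by auto
    have meas: "(\<lambda>x. ennreal (g i x)) \<in> borel_measurable (PiM (insert i ?J) (\<lambda>_. F))"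
      unfolding ins using g[OF i] by measurable
    have "(\<integral>\<^sup>+x. ennreal (g i x) \<partial>profiles N) = (\<integral>\<^sup>+x. \<integral>\<^sup>+y. ennreal (g i (x(i := y))) \<partial>F \<partial>PiM ?J (\<lambda>_. F))"
      using PS.product_nn_integral_insert[OF _ _ meas] unfolding ins by simp
    also have "\<dots> \<le> (\<integral>\<^sup>+x. ennreal B \<partial>PiM ?J (\<lambda>_. F))"
    proof (rule nn_integral_mono)
      fix x :: "nat \<Rightarrow> real"
      \<comment> \<open>The others' values are fixed and only buyer i's own value is integrated.
        Resetting coordinate i makes his price constant, so the inner integral is a posted-price
        profit with unit cost c, which \<open>rev\<close> bounds.\<close>
      have price_upd: "price i (x(i := y)) = price i x" for y by (simp add: price_def)
      have "(\<integral>\<^sup>+y. ennreal (g i (x(i := y))) \<partial>F) = (\<integral>\<^sup>+y. ennreal (max 0 (price i x - c)) * indicator {price i x..} y \<partial>F)"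
        by (intro nn_integral_cong) (simp add: g_def price_upd indicator_def)
      also have "\<dots> = ennreal (max 0 (price i x - c)) * ennreal (prob {price i x..})"
        by (simp add: nn_integral_cmult_indicator sets_F emeasure_eq_measure)
      also have "\<dots> = ennreal (max 0 (price i x - c) * prob {price i x..})"
        by (simp add: ennreal_mult)
      also have "\<dots> \<le> ennreal B"
        using rev[of "price i x"] B by (intro ennreal_leI) (auto simp: max_def)
      finally show "(\<integral>\<^sup>+y. ennreal (g i (x(i := y))) \<partial>F) \<le> ennreal B" .
    qed
    also have "\<dots> = ennreal B" by (simp add: PJ.emeasure_space_1)
    finally show ?thesis .
  qed
  have "Rev_OPT m N F \<le> (\<integral>\<^sup>+x. ennreal (c * real m) + (\<Sum>i<N. ennreal (g i x)) \<partial>profiles N)"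
    unfolding Rev_OPT_def
  proof (rule nn_integral_mono_AE, use AE_all_bids[OF pos, of N] in eventually_elim)
    case (elim x)
    have "payment_OPT ?r m N x \<le> c * real m + (\<Sum>i<N. g i x)"
      using payment_OPT_upper[of N x m c ?r] elim N c unfolding g_def price_def Let_def by blast
    then have "ennreal (payment_OPT ?r m N x) \<le> ennreal (c * real m + (\<Sum>i<N. g i x))"
      by (rule ennreal_leI)
    also have "\<dots> = ennreal (c * real m) + (\<Sum>i<N. ennreal (g i x))"
      using c by (subst ennreal_plus) (auto simp: g_def sum_nonneg intro!: sum_ennreal[symmetric])
    finally show ?case .
  qed
  also have "\<dots> = ennreal (c * real m) + (\<Sum>i<N. \<integral>\<^sup>+x. ennreal (g i x) \<partial>profiles N)"
    using g by (subst nn_integral_add, simp, simp, subst nn_integral_sum) (auto simp: P.emeasure_space_1)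
  also have "\<dots> \<le> ennreal (c * real m) + (\<Sum>i<N. ennreal B)"
    using g_le by (intro add_left_mono sum_mono) auto
  also have "\<dots> = ennreal (c * real m + real N * B)"
    using c B by (simp add: ennreal_mult ennreal_of_nat_eq_real_of_nat)
  finally show ?thesis .
qed

end

subsection \<open>Regularity as convexity\<close>

text \<open>The quantile function of the generalized Pareto distribution; its inverse is the survival
  function of the distribution whose virtual value is constant.\<close>

definition pareto_quantile :: "real \<Rightarrow> real \<Rightarrow> real" where
  "pareto_quantile lam q = (if lam = 0 then - ln q else (q powr (- lam) - 1) / lam)"

text \<open>The logarithmic loss of survival over a time \<open>t\<close> when the inverse hazard rate starts at \<open>w\<close> and
  grows at rate \<open>lam\<close>.\<close>

definition hazard_integral :: "real \<Rightarrow> real \<Rightarrow> real \<Rightarrow> real" where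
  "hazard_integral lam w t = (if lam = 0 then t / w else ln (1 + lam * t / w) / lam)"

lemma hazard_integral_0 [simp]: "hazard_integral lam w 0 = 0"
  by (simp add: hazard_integral_def)

text \<open>The hazard integral has integrand \<open>1 / (w + lam * s)\<close>, which does not
  increase, so its endpoint values bound the increment. For positive lam this is
  \<open>ln x \<le> x - 1\<close>, applied to the ratio of the endpoints and to its
  reciprocal.\<close>

lemma hazard_integral_increment:
  assumes "0 \<le> lam" "0 < w" "s \<le> t" "0 < w + lam * s"
  shows "hazard_integral lam w t - hazard_integral lam w s \<le> (t - s) / (w + lam * s)" (is ?upper)
    and "(t - s) / (w + lam * t) \<le> hazard_integral lam w t - hazard_integral lam w s" (is ?lower)
proof -
  have t: "w + lam * s \<le> w + lam * t" using assms by (simp add: mult_left_mono)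
  have "?upper \<and> ?lower"
  proof (cases "lam = 0")
    case True
    then show ?thesis by (simp add: hazard_integral_def diff_divide_distrib)
  next
    case False
    then have lam: "0 < lam" using assms by simp
    have eq: "hazard_integral lam w t - hazard_integral lam w s = ln ((w + lam * t) / (w + lam * s)) / lam"
    proof -
      have "1 + lam * t / w = (w + lam * t) / w" "1 + lam * s / w = (w + lam * s) / w"
        using assms by (simp_all add: field_simps)
      moreover have "0 < w + lam * t" using assms t by linarith
      ultimately show ?thesis using False assms
        by (simp add: hazard_integral_def ln_div diff_divide_distrib)
    qed
    have "ln ((w + lam * t) / (w + lam * s)) \<le> (w + lam * t) / (w + lam * s) - 1"
      using assms t by (intro ln_le_minus_one) auto
    also have "\<dots> = lam * ((t - s) / (w + lam * s))" using assms by (simp add: field_simps)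
    finally have upper: ?upper unfolding eq using lam by (simp add: field_simps)
    have "ln ((w + lam * s) / (w + lam * t)) \<le> (w + lam * s) / (w + lam * t) - 1"
      using assms t by (intro ln_le_minus_one) auto
    also have "\<dots> = - (lam * ((t - s) / (w + lam * t)))" using assms t by (simp add: field_simps)
    also have "ln ((w + lam * s) / (w + lam * t)) = - ln ((w + lam * t) / (w + lam * s))"
      using assms t by (simp add: ln_div)
    finally have "lam * ((t - s) / (w + lam * t)) \<le> ln ((w + lam * t) / (w + lam * s))" by simp
    then have ?lower unfolding eq using lam by (simp add: pos_le_divide_eq mult.commute)
    with upper show ?thesis ..
  qed
  then show ?upper ?lower by auto
qed

text \<open>Over n equal steps the defects add up to \<open>C * (b - a)^2 / n\<close>, which
  vanishes in the limit. This integrates a differential inequality without assuming J differentiable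
  or even continuous.\<close>

lemma nondecreasing_if_quadratic_defect:
  fixes J :: "real \<Rightarrow> real"
  assumes ab: "a \<le> b" and d: "0 < d"
    and defect: "\<And>x y. a \<le> x \<Longrightarrow> x \<le> y \<Longrightarrow> y \<le> b \<Longrightarrow> y - x \<le> d \<Longrightarrow> J x - C * (y - x)\<^sup>2 \<le> J y"
  shows "J a \<le> J b"
proof -
  have lim: "(\<lambda>n. J a - C * (b - a)\<^sup>2 * inverse (real (Suc n))) \<longlonglongrightarrow> J a - C * (b - a)\<^sup>2 * 0"
    by (intro tendsto_intros LIMSEQ_inverse_real_of_nat)
  have "\<forall>\<^sub>F n in sequentially. (b - a) * inverse (real (Suc n)) < d"
    using d by (intro order_tendstoD[OF tendsto_mult_right_zero[OF LIMSEQ_inverse_real_of_nat]])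
  then have "\<forall>\<^sub>F n in sequentially. J a - C * (b - a)\<^sup>2 * inverse (real (Suc n)) \<le> J b"
  proof eventually_elim
    case (elim n)
    define h where "h = (b - a) / real (Suc n)"
    define x where "x i = a + real i * h" for i
    have h: "0 \<le> h" "h \<le> d" using elim ab by (auto simp: h_def divide_inverse)
    have end_pt: "x (Suc n) = b" "x 0 = a" by (auto simp: x_def h_def)
    have "J (x i) - C * h\<^sup>2 \<le> J (x (Suc i))" if "i < Suc n" for i
    proof -
      have "real (Suc i) * h \<le> real (Suc n) * h" using that h by (intro mult_right_mono) auto
      then have "x (Suc i) \<le> b" using end_pt by (simp add: x_def)
      moreover have "x (Suc i) - x i = h" by (simp add: x_def algebra_simps)
      moreover have "a \<le> x i" using h by (simp add: x_def)
      ultimately show ?thesis using defect[of "x i" "x (Suc i)"] h by simp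
    qed
    then have "(\<Sum>i<Suc n. - (C * h\<^sup>2)) \<le> (\<Sum>i<Suc n. J (x (Suc i)) - J (x i))"
      by (intro sum_mono) force
    also have "\<dots> = J b - J a"
      using end_pt by (subst sum_lessThan_telescope[of "\<lambda>i. J (x i)"]) simp
    finally have "J a - real (Suc n) * (C * h\<^sup>2) \<le> J b" by simp
    moreover have "real (Suc n) * (C * h\<^sup>2) = C * (b - a)\<^sup>2 * inverse (real (Suc n))"
    proof -
      have "real (Suc n) * (C * h\<^sup>2) = C * (real (Suc n) * h) * h" by (simp add: power2_eq_square)
      also have "real (Suc n) * h = b - a" by (simp add: h_def)
      finally show ?thesis by (simp add: h_def power2_eq_square divide_inverse mult.assoc)
    qed
    ultimately show ?case by (simp only:)
  qed
  then have "J a - C * (b - a)\<^sup>2 * 0 \<le> J b"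
    by (rule tendsto_upperbound[OF lim _ trivial_limit_sequentially])
  then show ?thesis by simp
qed

text \<open>\<open>decay\<close> is the incremental form of a hazard rate of at least
  \<open>1 / (w + lam * (x - z))\<close> to the right of z. The difference J of the two logarithmic
  losses is then nondecreasing up to second order.\<close>

lemma survival_after:
  fixes S :: "real \<Rightarrow> real"
  assumes lam: "0 \<le> lam" and w: "0 < w" and zu: "z \<le> u" and pos: "\<And>x. z \<le> x \<Longrightarrow> x \<le> u \<Longrightarrow> 0 < S x"
    and decay: "\<And>x y. z \<le> x \<Longrightarrow> x \<le> y \<Longrightarrow> y \<le> u \<Longrightarrow> (y - x) * (S y / (w + lam * (y - z))) \<le> S x - S y"
  shows "ln (S u) \<le> ln (S z) - hazard_integral lam w (u - z)"
proof -
  define J where "J x = - ln (S x) - hazard_integral lam w (x - z)" for x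
  have "J z \<le> J u"
  \<comment> \<open>In C, the 1 comes from \<open>ln (1 + s) \<ge> s - s^2\<close> and lam from
    replacing the denominator at y by the one at x. Steps of length at most w keep s within
    [0, 1].\<close>
  proof (rule nondecreasing_if_quadratic_defect[OF zu w, where C = "(1 + lam) / w\<^sup>2"])
    fix x y assume xy: "z \<le> x" "x \<le> y" "y \<le> u" "y - x \<le> w"
    let ?h = "y - x" and ?X = "w + lam * (x - z)" and ?Y = "w + lam * (y - z)"
    have X: "w \<le> ?X" using xy lam by simp
    have Y: "?Y = ?X + lam * ?h" by (simp add: algebra_simps)
    have Y': "w \<le> ?Y" using xy lam by simp
    have S: "0 < S x" "0 < S y" using pos xy by auto
    have "S y * (1 + ?h / ?Y) \<le> S x" using decay[OF xy(1-3)] by (simp add: algebra_simps)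
    then have "ln (S y * (1 + ?h / ?Y)) \<le> ln (S x)"
      using S xy Y' w by (subst ln_le_cancel_iff) (auto intro!: mult_pos_pos add_pos_nonneg)
    also have "ln (S y * (1 + ?h / ?Y)) = ln (S y) + ln (1 + ?h / ?Y)"
      using S xy Y' w by (intro ln_mult_pos) (auto intro!: add_pos_nonneg)
    finally have "ln (S y) + ln (1 + ?h / ?Y) \<le> ln (S x)" .
    moreover have "?h / ?Y - (?h / ?Y)\<^sup>2 \<le> ln (1 + ?h / ?Y)"
      using xy Y' w by (intro ln_one_plus_pos_lower_bound) auto
    moreover have "(?h / ?Y)\<^sup>2 \<le> (?h / w)\<^sup>2"
      using xy Y' w by (intro power_mono divide_left_mono) auto
    moreover have "?h / ?X - ?h / ?Y \<le> lam * (?h / w)\<^sup>2"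
    proof -
      have "?h / ?X - ?h / ?Y = lam * (?h * ?h / (?X * ?Y))"
        using X Y' w unfolding Y by (simp add: field_simps)
      also have "\<dots> \<le> lam * (?h * ?h / (w * w))"
        using X Y' w lam by (intro mult_left_mono divide_left_mono mult_mono) auto
      finally show ?thesis by (simp add: power2_eq_square)
    qed
    moreover have "hazard_integral lam w (y - z) - hazard_integral lam w (x - z) \<le> ?h / ?X"
      using hazard_integral_increment(1)[of lam w "x - z" "y - z"] lam w xy X by simp
    moreover have "(1 + lam) / w\<^sup>2 * ?h\<^sup>2 = (?h / w)\<^sup>2 + lam * (?h / w)\<^sup>2"
      by (simp add: power_divide add_divide_distrib distrib_right)
    ultimately show "J x - (1 + lam) / w\<^sup>2 * ?h\<^sup>2 \<le> J y"
      unfolding J_def by linarith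
  qed
  then show ?thesis by (simp add: J_def)
qed

text \<open>The mirror image: left of z the hazard rate is at most that of the comparison function,
  so survival at u cannot be too large. The affine denominator is smallest at u, where
  \<open>wu\<close> keeps it positive.\<close>

lemma survival_before:
  fixes S :: "real \<Rightarrow> real"
  assumes lam: "0 \<le> lam" and w: "0 < w" and uz: "u \<le> z" and wu: "0 < w + lam * (u - z)"
    and pos: "\<And>x. u \<le> x \<Longrightarrow> x \<le> z \<Longrightarrow> 0 < S x"
    and decay: "\<And>x y. u \<le> x \<Longrightarrow> x \<le> y \<Longrightarrow> y \<le> z \<Longrightarrow> S x - S y \<le> (y - x) * (S x / (w + lam * (x - z)))"
  shows "ln (S u) \<le> ln (S z) - hazard_integral lam w (u - z)"
proof -
  define J where "J x = ln (S x) + hazard_integral lam w (x - z)" for x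
  define w' where "w' = w + lam * (u - z)"
  have w': "0 < w'" "0 < w' / 2" using wu by (auto simp: w'_def)
  have "J u \<le> J z"
  \<comment> \<open>The 2 in C comes from \<open>ln (1 - s) \<ge> - s - 2 * s^2\<close>, valid for s
    up to 1/2; this is why steps are limited to half of the smallest denominator.\<close>
  proof (rule nondecreasing_if_quadratic_defect[OF uz w'(2), where C = "(2 + lam) / w'\<^sup>2"])
    fix x y assume xy: "u \<le> x" "x \<le> y" "y \<le> z" "y - x \<le> w' / 2"
    let ?h = "y - x" and ?X = "w + lam * (x - z)" and ?Y = "w + lam * (y - z)"
    have X: "w' \<le> ?X" and Y: "?Y = ?X + lam * ?h"
      using xy mult_left_mono[of "u - z" "x - z" lam] lam by (auto simp: algebra_simps w'_def)
    have "0 \<le> lam * ?h" using xy lam by simp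
    with X Y have Y': "w' \<le> ?Y" by linarith
    have S: "0 < S x" "0 < S y" using pos xy by auto
    have half: "0 \<le> ?h / ?X" "?h / ?X \<le> 1 / 2" using xy X w' by (auto simp: field_simps)
    then have half': "0 < 1 - ?h / ?X" by linarith
    have "S x * (1 - ?h / ?X) \<le> S y" using decay[OF xy(1-3)] by (simp add: algebra_simps)
    then have "ln (S x * (1 - ?h / ?X)) \<le> ln (S y)"
      using mult_pos_pos[OF S(1) half'] S by (subst ln_le_cancel_iff) auto
    also have "ln (S x * (1 - ?h / ?X)) = ln (S x) + ln (1 - ?h / ?X)"
      by (intro ln_mult_pos S half')
    finally have "ln (S x) + ln (1 - ?h / ?X) \<le> ln (S y)" .
    moreover have "- (?h / ?X) - 2 * (?h / ?X)\<^sup>2 \<le> ln (1 - ?h / ?X)"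
      using half by (intro ln_one_minus_pos_lower_bound) auto
    moreover have "(?h / ?X)\<^sup>2 \<le> (?h / w')\<^sup>2"
      using xy X w' by (intro power_mono divide_left_mono) auto
    moreover have "?h / ?X - ?h / ?Y \<le> lam * (?h / w')\<^sup>2"
    proof -
      have "?h / ?X - ?h / ?Y = lam * (?h * ?h / (?X * ?Y))"
        using X Y' w' unfolding Y by (simp add: field_simps)
      also have "\<dots> \<le> lam * (?h * ?h / (w' * w'))"
        using X Y' w' lam by (intro mult_left_mono divide_left_mono mult_mono) auto
      finally show ?thesis by (simp add: power2_eq_square)
    qed
    moreover have "?h / ?Y \<le> hazard_integral lam w (y - z) - hazard_integral lam w (x - z)"
      using hazard_integral_increment(2)[of lam w "x - z" "y - z"] lam w w' xy X by simp
    moreover have "(2 + lam) / w'\<^sup>2 * ?h\<^sup>2 = 2 * (?h / w')\<^sup>2 + lam * (?h / w')\<^sup>2"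
      by (simp add: power_divide add_divide_distrib distrib_right)
    ultimately show "J x - (2 + lam) / w'\<^sup>2 * ?h\<^sup>2 \<le> J y"
      unfolding J_def by linarith
  qed
  then show ?thesis by (simp add: J_def)
qed

text \<open>Along the comparison function \<open>q * exp (- hazard_integral lam w t)\<close> the
  Pareto quantile is affine in t with this slope, so a bound on the logarithm becomes a line. Where
  \<open>w + lam * t \<le> 0\<close> the line is at most \<open>- 1 / lam\<close>, a lower bound of
  the quantile, and nothing has to be assumed.\<close>

lemma pareto_quantile_above_line:
  assumes lam: "0 \<le> lam" and w: "0 < w" and q: "0 < q" "0 < q'"
    and le: "0 < w + lam * t \<Longrightarrow> ln q' \<le> ln q - hazard_integral lam w t"
  shows "pareto_quantile lam q + q powr (- lam) / w * t \<le> pareto_quantile lam q'"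
proof (cases "lam = 0")
  case True
  then show ?thesis using le w q by (simp add: pareto_quantile_def hazard_integral_def)
next
  case False
  then have lam0: "0 < lam" using lam by simp
  have "q powr (- lam) * (1 + lam * t / w) \<le> q' powr (- lam)"
  proof (cases "0 < w + lam * t")
    case True
    then have t: "0 < 1 + lam * t / w" using w by (simp add: field_simps)
    have "lam * ln q' \<le> lam * (ln q - ln (1 + lam * t / w) / lam)"
      using le[OF True] lam by (intro mult_left_mono) (simp_all add: hazard_integral_def False)
    then have "- lam * ln q + ln (1 + lam * t / w) \<le> - lam * ln q'"
      using lam0 by (simp add: algebra_simps)
    then have "exp (- lam * ln q + ln (1 + lam * t / w)) \<le> exp (- lam * ln q')"
      by (rule exp_le_cancel_iff[THEN iffD2])
    then have "exp (- lam * ln q) * (1 + lam * t / w) \<le> exp (- lam * ln q')"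
      using t by (simp only: exp_add exp_ln)
    then show ?thesis using q by (simp add: powr_def)
  next
    case False
    then have "1 + lam * t / w \<le> 0" using w by (simp add: field_simps)
    then have "q powr (- lam) * (1 + lam * t / w) \<le> 0" by (simp add: mult_nonneg_nonpos)
    then show ?thesis using powr_ge_zero order_trans by blast
  qed
  then have "(q powr (- lam) * (1 + lam * t / w) - 1) / lam \<le> (q' powr (- lam) - 1) / lam"
    using lam0 by (intro divide_right_mono) auto
  then show ?thesis using False w by (simp add: pareto_quantile_def field_simps)
qed

lemma pareto_quantile_1 [simp]: "pareto_quantile lam 1 = 0"
  by (simp add: pareto_quantile_def)

lemma pareto_quantile_strict_antimono:
  assumes "0 \<le> lam" "0 < p" "p < q"
  shows "pareto_quantile lam q < pareto_quantile lam p"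
proof (cases "lam = 0")
  case False
  then have "q powr (- lam) < p powr (- lam)"
    using assms by (intro powr_less_mono2_neg) auto
  then show ?thesis using False assms by (simp add: pareto_quantile_def divide_strict_right_mono)
qed (use assms in \<open>simp add: pareto_quantile_def\<close>)

lemma pareto_quantile_antimono:
  assumes "0 \<le> lam" "0 < p" "p \<le> q"
  shows "pareto_quantile lam q \<le> pareto_quantile lam p"
  using pareto_quantile_strict_antimono[of lam p q] assms by (cases "p = q") auto

lemma pareto_quantile_nonneg:
  assumes "0 \<le> lam" "0 < q" "q \<le> 1"
  shows "0 \<le> pareto_quantile lam q"
  using pareto_quantile_antimono[of lam q 1] assms by simp

lemma pareto_quantile_pos:
  assumes "0 \<le> lam" "0 < q" "q < 1"
  shows "0 < pareto_quantile lam q"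
  using pareto_quantile_strict_antimono[of lam q 1] assms by simp

section \<open>Support, survival function and density of a valuation distribution\<close>

locale valuation =
  fixes F :: "real measure"
  assumes valuation_distribution: "valuation_distribution F"

sublocale valuation \<subseteq> iid_bids F
  using valuation_distribution
  by (auto simp: valuation_distribution_def iid_bids_def iid_bids_axioms_def)

context valuation
begin

abbreviation S :: "real \<Rightarrow> real" where "S x \<equiv> prob {x..}"

lemma sets_borel [simp]: "A \<in> sets borel \<Longrightarrow> A \<in> events"
  by (simp add: sets_F)

lemma AE_nonneg: "AE v in F. 0 \<le> v"
  and interval_supp: "is_interval (supp F)"
  using valuation_distribution unfolding valuation_distribution_def by blast+

lemma S_diff:
  assumes "x \<le> y"
  shows "S x - S y = prob {x..<y}"
proof -
  have "{x..} - {y..} = {x..<y}" by auto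
  then show ?thesis using finite_measure_Diff[of "{x..}" "{y..}"] assms by simp
qed

lemma S_antimono: "x \<le> y \<Longrightarrow> S y \<le> S x"
  by (intro finite_measure_mono) auto

lemma cdf_lt_eq: "1 - cdf_lt F v = S v"
proof -
  have "{v..} = space F - {..<v}" by auto
  then show ?thesis using prob_compl[of "{..<v}"] by (simp add: cdf_lt_def)
qed

text \<open>The complement of the support is the union of all null open sets; by the Lindelof
  property countably many of them suffice.\<close>

lemma null_off_supp: "- supp F \<in> null_sets F"
proof -
  let ?U = "{U. open U \<and> prob U = 0}"
  obtain V where V: "V \<subseteq> ?U" "countable V" "\<Union>V = \<Union>?U"
    by (rule Lindelof[of ?U]) auto
  have "(\<Union>U\<in>V. U) \<in> null_sets F"
    using V by (intro null_sets_UN') (auto intro!: null_setsI simp: emeasure_eq_measure)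
  moreover have "- supp F = \<Union>?U"
    by (auto simp: supp_def not_less measure_le_0_iff)
  ultimately show ?thesis using V by simp
qed

lemma closed_supp: "closed (supp F)"
proof -
  have "- supp F = \<Union>{U. open U \<and> prob U = 0}"
    by (auto simp: supp_def not_less measure_le_0_iff)
  then show ?thesis unfolding closed_def by auto
qed

lemma prob_Int_supp:
  assumes "A \<in> sets borel"
  shows "prob (A \<inter> supp F) = prob A"
proof -
  have "prob A = prob (A - (- supp F))"
    using assms null_off_supp by (intro measure_Diff_null_set[symmetric]) auto
  also have "A - (- supp F) = A \<inter> supp F" by auto
  finally show ?thesis ..
qed

lemma supp_nonneg:
  assumes "x \<in> supp F"
  shows "0 \<le> x"
proof (rule ccontr)
  assume "\<not> 0 \<le> x"
  then have "0 < prob {..<0}" using assms by (auto simp: supp_def)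
  moreover have "prob {..<0} = 0"
    using AE_nonneg by (subst prob_eq_0) auto
  ultimately show False by simp
qed

lemma supp_above:
  assumes "0 < S x"
  obtains y where "y \<in> supp F" "x \<le> y"
proof -
  have "prob ({x..} \<inter> supp F) \<noteq> 0" using assms prob_Int_supp[of "{x..}"] by simp
  then have "{x..} \<inter> supp F \<noteq> {}" by auto
  then show ?thesis using that by auto
qed

lemma S_pos:
  assumes "y \<in> supp F" "x < y"
  shows "0 < S x"
proof -
  have "0 < prob {x<..}" using assms by (auto simp: supp_def)
  also have "\<dots> \<le> S x" by (intro finite_measure_mono) auto
  finally show ?thesis .
qed

lemma S_eq_1:
  assumes "\<And>y. y \<in> supp F \<Longrightarrow> z \<le> y"
  shows "S z = 1"
proof -
  have "prob {z..} = prob ({z..} \<inter> supp F)" by (simp add: prob_Int_supp)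
  also have "{z..} \<inter> supp F = UNIV \<inter> supp F" using assms by auto
  also have "prob \<dots> = 1" using prob_Int_supp[of UNIV] prob_space by simp
  finally show ?thesis .
qed

lemma S_nonpos: "x \<le> 0 \<Longrightarrow> S x = 1"
  using supp_nonneg order_trans by (intro S_eq_1) blast

lemma supp_convex: "x \<in> supp F \<Longrightarrow> y \<in> supp F \<Longrightarrow> x \<le> z \<Longrightarrow> z \<le> y \<Longrightarrow> z \<in> supp F"
  using interval_supp unfolding is_interval_1 by blast

lemma supp_belowI: "x \<in> supp F \<Longrightarrow> y \<in> supp F \<Longrightarrow> x < y \<Longrightarrow> x \<in> supp_below F"
  by (auto simp: supp_below_def)

lemma S_pos_below: "x \<in> supp_below F \<Longrightarrow> 0 < S x"
  using S_pos by (auto simp: supp_below_def)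

text \<open>Survival is positive on \<open>supp_below\<close>, so a vanishing density gives an
  infinite quotient and never 0/0.\<close>

lemma virtual_value_eq:
  assumes "density_below F f" "v \<in> supp_below F"
  shows "ereal (lam * v) - ereal (1 - cdf_lt F v) / ereal (f v)
    = (if f v = 0 then - \<infinity> else ereal (lam * v - S v / f v))"
  using S_pos_below[OF assms(2)] by (simp add: cdf_lt_eq)

text \<open>Adding the nondecreasing term \<open>(lam' - lam) * v\<close> preserves monotonicity. It
  gives access to \<open>lam' = 1\<close>, where the convex function is
  \<open>1 / S - 1\<close>.\<close>

lemma lambda_regular_mono:
  assumes "lambda_regular lam F" "lam \<le> lam'"
  shows "lambda_regular lam' F"
proof -
  obtain f where f: "density_below F f"
    and mono: "mono_on (supp_below F) (\<lambda>v. ereal (lam * v) - ereal (1 - cdf_lt F v) / ereal (f v))"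
    using assms by (auto simp: lambda_regular_def)
  have "mono_on (supp_below F) (\<lambda>v. ereal (lam' * v) - ereal (1 - cdf_lt F v) / ereal (f v))"
  proof (rule mono_onI)
    fix x y assume xy: "x \<in> supp_below F" "y \<in> supp_below F" "x \<le> y"
    have shift: "(lam' - lam) * x \<le> (lam' - lam) * y" using assms xy by (intro mult_left_mono) auto
    have "(if f x = 0 then - \<infinity> else ereal (lam * x - S x / f x)) \<le> (if f y = 0 then - \<infinity> else ereal (lam * y - S y / f y))"
      using mono_onD[OF mono xy] unfolding virtual_value_eq[OF f xy(1)] virtual_value_eq[OF f xy(2)] .
    then have "f x = 0 \<or> f y \<noteq> 0 \<and> lam * x - S x / f x \<le> lam * y - S y / f y"
      by (simp split: if_splits)
    then have "f x = 0 \<or> f y \<noteq> 0 \<and> lam' * x - S x / f x \<le> lam' * y - S y / f y"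
      using shift unfolding left_diff_distrib by linarith
    then show "ereal (lam' * x) - ereal (1 - cdf_lt F x) / ereal (f x) \<le> ereal (lam' * y) - ereal (1 - cdf_lt F y) / ereal (f y)"
      unfolding virtual_value_eq[OF f xy(1)] virtual_value_eq[OF f xy(2)]
      by auto
  qed
  with f show ?thesis by (auto simp: lambda_regular_def)
qed

text \<open>The support must appear in the integrand: outside \<open>supp_below\<close> the function
  f is arbitrary up to measurability and sign.\<close>

lemma emeasure_density_supp:
  assumes "density_below F f" "A \<in> sets borel" "A \<inter> supp F \<subseteq> supp_below F"
  shows "ennreal (prob A) = (\<integral>\<^sup>+v. ennreal (f v) * indicator (A \<inter> supp F) v \<partial>lborel)"
proof -
  have "ennreal (prob A) = emeasure F (A \<inter> supp F)"
    using assms(2) by (simp add: emeasure_eq_measure prob_Int_supp)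
  also have "\<dots> = (\<integral>\<^sup>+v. ennreal (f v) * indicator (A \<inter> supp F) v \<partial>lborel)"
  proof -
    have "A \<inter> supp F \<in> sets borel" by (intro sets.Int borel_closed closed_supp assms(2))
    moreover have "\<forall>A\<in>sets borel. A \<subseteq> supp_below F \<longrightarrow> emeasure F A = (\<integral>\<^sup>+v\<in>A. ennreal (f v) \<partial>lborel)"
      using assms(1) unfolding density_below_def by (elim conjE)
    ultimately show ?thesis using assms(3) by (elim ballE impE) auto
  qed
  finally show ?thesis .
qed

lemma prob_le_if_density_le:
  assumes f: "density_below F f" and xy: "x \<le> y" and sub: "{x..<y} \<inter> supp F \<subseteq> supp_below F"
    and K: "0 \<le> K" "\<And>v. x \<le> v \<Longrightarrow> v < y \<Longrightarrow> v \<in> supp F \<Longrightarrow> f v \<le> K"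
  shows "prob {x..<y} \<le> (y - x) * K"
proof -
  have "ennreal (prob {x..<y}) = (\<integral>\<^sup>+v. ennreal (f v) * indicator ({x..<y} \<inter> supp F) v \<partial>lborel)"
    by (rule emeasure_density_supp[OF f _ sub]) simp
  also have "\<dots> \<le> (\<integral>\<^sup>+v. ennreal K * indicator {x..<y} v \<partial>lborel)"
    using K by (intro nn_integral_mono) (auto simp: indicator_def intro!: ennreal_leI)
  also have "\<dots> = ennreal ((y - x) * K)"
    using xy K by (simp add: nn_integral_cmult_indicator ennreal_mult mult.commute)
  finally show ?thesis using xy K by (subst (asm) ennreal_le_iff) auto
qed

lemma prob_ge_if_density_ge:
  assumes f: "density_below F f" and xy: "x \<le> y" and sub: "{x..<y} \<subseteq> supp_below F"
    and K: "0 \<le> K" "\<And>v. x \<le> v \<Longrightarrow> v < y \<Longrightarrow> K \<le> f v"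
  shows "(y - x) * K \<le> prob {x..<y}"
proof -
  have eq: "{x..<y} \<inter> supp F = {x..<y}" using sub by (auto simp: supp_below_def)
  have "ennreal ((y - x) * K) = (\<integral>\<^sup>+v. ennreal K * indicator {x..<y} v \<partial>lborel)"
    using xy K by (simp add: nn_integral_cmult_indicator ennreal_mult mult.commute)
  also have "\<dots> \<le> (\<integral>\<^sup>+v. ennreal (f v) * indicator {x..<y} v \<partial>lborel)"
    using K by (intro nn_integral_mono) (auto simp: indicator_def intro!: ennreal_leI)
  also have "\<dots> = ennreal (prob {x..<y})"
    using emeasure_density_supp[OF f, of "{x..<y}"] sub eq by simp
  finally show ?thesis by (subst (asm) ennreal_le_iff) auto
qed

text \<open>Regularity says that the inverse hazard rate at \<open>v\<close> minus \<open>lam * v\<close> decreases. Comparing the inverse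
  hazard rate on either side of \<open>z\<close> with its affine interpolant of slope \<open>lam\<close> at \<open>z\<close> bounds the survival
  function by that of a generalized Pareto distribution. No continuity of the density is available, so the
  comparison is made on increments, with an error of second order.\<close>

lemma supporting_line:
  assumes reg: "lambda_regular lam F" and lam: "0 \<le> lam" and b: "b \<in> supp F" "z < b"
  shows "\<exists>s\<ge>0. \<forall>u. 0 < S u \<longrightarrow> pareto_quantile lam (S z) + s * (u - z) \<le> pareto_quantile lam (S u)"
proof -
  obtain f where f: "density_below F f"
    and mono: "mono_on (supp_below F) (\<lambda>v. ereal (lam * v) - ereal (1 - cdf_lt F v) / ereal (f v))"
    using reg by (auto simp: lambda_regular_def)
  have f_nonneg: "0 \<le> f v" for v using f by (simp add: density_below_def)
  have vv: "(if f x = 0 then - \<infinity> else ereal (lam * x - S x / f x)) \<le> (if f y = 0 then - \<infinity> else ereal (lam * y - S y / f y))"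
    if "x \<in> supp_below F" "y \<in> supp_below F" "x \<le> y" for x y
    using mono_onD[OF mono that] unfolding virtual_value_eq[OF f that(1)] virtual_value_eq[OF f that(2)] .
  show ?thesis
  proof (cases "z \<in> supp_below F \<and> f z \<noteq> 0")
    case False
    \<comment> \<open>If the support had a point y below z, then \<open>f z = 0\<close> and the
      virtual value at z would be minus infinity; monotonicity would make f vanish on
      \<open>{y..<z}\<close>, a null interval inside the support. So \<open>S z = 1\<close>, and the
      horizontal line through 0 supports.\<close>
    have "z \<le> y" if y: "y \<in> supp F" for y
    proof (rule ccontr)
      assume "\<not> z \<le> y"
      then have yz: "y < z" by simp
      then have z: "z \<in> supp_below F" using supp_convex[OF y b(1)] b by (intro supp_belowI) auto
      with False have fz: "f z = 0" by simp
      have below: "v \<in> supp_below F" if "y \<le> v" "v < z" for v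
        using supp_convex[OF y b(1)] b that by (intro supp_belowI[of v b]) auto
      have "prob {y..<z} \<le> (z - y) * 0"
      proof (rule prob_le_if_density_le[OF f])
        fix v assume v: "y \<le> v" "v < z"
        show "f v \<le> 0" using vv[OF below[OF v] z] v fz by (auto split: if_splits)
      qed (use yz below in auto)
      moreover have "prob {y<..<z} \<le> prob {y..<z}" by (intro finite_measure_mono) auto
      ultimately have "prob {y<..<z} = 0" using measure_nonneg[of F "{y<..<z}"] by linarith
      moreover obtain x where "y < x" "x < z" using yz dense by blast
      moreover from this have "x \<in> supp F" using below[of x] by (simp add: supp_below_def)
      then have "\<forall>U. open U \<longrightarrow> x \<in> U \<longrightarrow> 0 < prob U" by (simp add: supp_def)
      ultimately show False using open_greaterThanLessThan[of y z] by force
    qed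
    then have "S z = 1" by (rule S_eq_1)
    then show ?thesis using lam by (intro exI[of _ 0]) (simp add: pareto_quantile_nonneg)
  next
    case True
    then have z: "z \<in> supp_below F" and fz: "0 < f z" using f_nonneg[of z] by auto
    define w where "w = S z / f z"
    have w: "0 < w" using fz S_pos_below[OF z] by (simp add: w_def)
    \<comment> \<open>The slope is that of the comparison function which shares value and inverse
      hazard rate w with F at z.\<close>
    have "pareto_quantile lam (S z) + S z powr (- lam) / w * (u - z) \<le> pareto_quantile lam (S u)"
      if u: "0 < S u" for u
    proof (rule pareto_quantile_above_line[OF lam w S_pos_below[OF z] u])
      assume wu: "0 < w + lam * (u - z)"
      obtain c where c: "c \<in> supp F" "u \<le> c" using supp_above[OF u] .
      show "ln (S u) \<le> ln (S z) - hazard_integral lam w (u - z)"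
      proof (cases "z \<le> u")
        case zu: True
        show ?thesis
        proof (rule survival_after[OF lam w zu])
          fix x assume "z \<le> x" "x \<le> u"
          then show "0 < S x" using u S_antimono[of x u] by linarith
        next
          fix x y assume xy: "z \<le> x" "x \<le> y" "y \<le> u"
          have W: "0 < w + lam * (v - z)" if "z \<le> v" for v using that w lam by (simp add: add_pos_nonneg)
          have below: "v \<in> supp_below F" if "x \<le> v" "v < y" for v
            using supp_convex[of z c v] z c that xy by (intro supp_belowI[of v c]) (auto simp: supp_below_def)
          have "(y - x) * (S y / (w + lam * (y - z))) \<le> prob {x..<y}"
          proof (rule prob_ge_if_density_ge[OF f xy(2)])
            fix v assume v: "x \<le> v" "v < y"
            \<comment> \<open>Monotone virtual values from z to v: to the right of z the inverse
              hazard rate lies below its affine comparison, and f stays positive.\<close>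
            have fv: "0 < f v" "S v / f v \<le> w + lam * (v - z)"
              using vv[OF z below[OF v]] fz f_nonneg[of v] v xy
              by (auto simp: w_def algebra_simps split: if_splits)
            have "S y / (w + lam * (y - z)) \<le> S v / (w + lam * (v - z))"
              using v xy W S_antimono[of v y] lam by (intro frac_le) (auto intro: mult_left_mono)
            also have "\<dots> \<le> f v" using fv W[of v] v xy by (simp add: field_simps)
            finally show "S y / (w + lam * (y - z)) \<le> f v" .
          qed (use below W[of y] xy in auto)
          then show "(y - x) * (S y / (w + lam * (y - z))) \<le> S x - S y" using xy by (simp add: S_diff)
        qed
      next
        case False
        then have uz: "u \<le> z" by simp
        show ?thesis
        proof (rule survival_before[OF lam w uz wu])
          fix x assume "u \<le> x" "x \<le> z"
          then show "0 < S x" using S_pos_below[OF z] S_antimono[of x z] by linarith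
        next
          fix x y assume xy: "u \<le> x" "x \<le> y" "y \<le> z"
          have W: "0 < w + lam * (v - z)" if "u \<le> v" for v
          proof -
            have "lam * (u - z) \<le> lam * (v - z)" using that lam by (intro mult_left_mono) auto
            then show ?thesis using wu by linarith
          qed
          have "prob {x..<y} \<le> (y - x) * (S x / (w + lam * (x - z)))"
          proof (rule prob_le_if_density_le[OF f xy(2)])
            show "{x..<y} \<inter> supp F \<subseteq> supp_below F"
              using z xy by (intro subsetI supp_belowI[of _ z]) (auto simp: supp_below_def)
            show "0 \<le> S x / (w + lam * (x - z))" using W[of x] xy by simp
            fix v assume v: "x \<le> v" "v < y" "v \<in> supp F"
            then have "v \<in> supp_below F"
              using z xy by (intro supp_belowI[of v z]) (auto simp: supp_below_def)
            \<comment> \<open>To the left of z the comparison is reversed; a zero density is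
              possible here and only helps the upper bound.\<close>
            from vv[OF this z] fz f_nonneg[of v] v xy have "f v = 0 \<or> 0 < f v \<and> w + lam * (v - z) \<le> S v / f v"
              by (auto simp: w_def algebra_simps split: if_splits)
            then have "f v \<le> S v / (w + lam * (v - z))"
              using W[of v] v xy by (auto simp: field_simps)
            also have "\<dots> \<le> S x / (w + lam * (x - z))"
              using v xy W S_antimono[of x v] lam by (intro frac_le) (auto intro: mult_left_mono)
            finally show "f v \<le> S x / (w + lam * (x - z))" .
          qed
          then show "S x - S y \<le> (y - x) * (S x / (w + lam * (x - z)))" using xy by (simp add: S_diff)
        qed
      qed
    qed
    moreover have "0 \<le> S z powr (- lam) / w" using w by simp
    ultimately show ?thesis by blast
  qed
qed

end

subsection \<open>Comparison of the two mechanisms\<close>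

context valuation
begin

lemma monopoly_reserve: "is_monopoly_reserve F (monopoly_reserve F)"
proof -
  have "\<exists>r. is_monopoly_reserve F r"
    using valuation_distribution unfolding valuation_distribution_def by (elim conjE)
  then show ?thesis unfolding monopoly_reserve_def by (rule someI_ex)
qed

lemma monopoly_reserve_in_supp: "monopoly_reserve F \<in> supp F"
  using monopoly_reserve by (simp add: is_monopoly_reserve_def)

lemma monopoly_revenue: "0 \<le> p \<Longrightarrow> p * S p \<le> monopoly_reserve F * S (monopoly_reserve F)"
  using monopoly_reserve by (simp add: is_monopoly_reserve_def cdf_lt_eq)

text \<open>The supporting line at p is evaluated at r and at 0, where the quantile of
  \<open>S 0 = 1\<close> is 0. Weights p and r - p cancel its slope.\<close>

lemma pareto_quantile_star_shaped:
  assumes reg: "lambda_regular lam F" "0 \<le> lam" and p: "0 \<le> p" "p < r" and r: "0 < S r"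
  shows "r * pareto_quantile lam (S p) \<le> p * pareto_quantile lam (S r)"
proof -
  obtain b where b: "b \<in> supp F" "r \<le> b" using supp_above[OF r] .
  then obtain s where s: "\<And>u. 0 < S u \<Longrightarrow> pareto_quantile lam (S p) + s * (u - p) \<le> pareto_quantile lam (S u)"
    using supporting_line[OF reg b(1), of p] p by auto
  have "p * (pareto_quantile lam (S p) + s * (r - p)) \<le> p * pareto_quantile lam (S r)"
    using s[OF r] p by (intro mult_left_mono) auto
  moreover have "(r - p) * (pareto_quantile lam (S p) - s * p) \<le> 0"
    using s[of 0] p S_nonpos[of 0] by (intro mult_nonneg_nonpos) auto
  ultimately show ?thesis by (simp add: algebra_simps)
qed

lemma S_vanishes:
  assumes "0 < a"
  obtains x where "S x < a"
proof -
  have "(\<lambda>n. prob {real n..}) \<longlonglongrightarrow> prob (\<Inter>n. {real n..})"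
    by (intro finite_Lim_measure_decseq) (auto simp: decseq_def)
  also have "(\<Inter>n. {real n..}) = {}"
  proof -
    have "x \<notin> (\<Inter>n. {real n..})" for x
    proof -
      obtain n where "x < real n" using reals_Archimedean2 by blast
      then show ?thesis by (auto simp: not_le)
    qed
    then show ?thesis by blast
  qed
  finally have "\<forall>\<^sub>F n in sequentially. prob {real n..} < a"
    using assms by (intro order_tendstoD(2)) auto
  then show ?thesis using that eventually_happens' sequentially_bot by blast
qed

text \<open>S is left-continuous, so the supremum t of prices accepted with probability at least a
  is such a price itself. Equality can fail only through an atom at t, which the density excludes
  below the right endpoint of the support.\<close>

lemma quantile_exists:
  assumes a: "0 < a" "a \<le> S r"
  obtains t where "r \<le> t" "a \<le> S t" "(\<exists>b\<in>supp F. t < b) \<Longrightarrow> S t = a"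
proof -
  define t where "t = Sup {x. a \<le> S x}"
  obtain B where B: "S B < a" using S_vanishes[OF a(1)] .
  have bdd: "bdd_above {x. a \<le> S x}"
  proof (rule bdd_aboveI[of _ B])
    fix x assume "x \<in> {x. a \<le> S x}"
    then show "x \<le> B" using B S_antimono[of B x] by (cases "x \<le> B") auto
  qed
  have r: "r \<le> t" unfolding t_def using a by (intro cSup_upper bdd) auto
  have below: "a \<le> S x" if xt: "x < t" for x
  proof -
    obtain y where "y \<in> {x. a \<le> S x}" "x < y"
      by (rule less_cSupE[of x "{x. a \<le> S x}"]) (use xt a in \<open>auto simp: t_def\<close>)
    then show ?thesis using S_antimono[of x y] by auto
  qed
  have above: "S x \<le> a" if "t < x" for x
  proof (rule ccontr)
    assume "\<not> S x \<le> a"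
    then have "x \<le> t" unfolding t_def by (intro cSup_upper bdd) auto
    with that show False by simp
  qed
  have "(\<lambda>n. prob {t - inverse (real (Suc n))..}) \<longlonglongrightarrow> prob (\<Inter>n. {t - inverse (real (Suc n))..})"
    by (intro finite_Lim_measure_decseq decseq_SucI) (auto intro: le_imp_inverse_le)
  also have "(\<Inter>n. {t - inverse (real (Suc n))..}) = {t..}"
  proof safe
    fix x assume x: "x \<in> (\<Inter>n. {t - inverse (real (Suc n))..})"
    have "(\<lambda>n. t - inverse (real (Suc n))) \<longlonglongrightarrow> t - 0"
      by (intro tendsto_intros LIMSEQ_inverse_real_of_nat)
    then have "t - 0 \<le> x" using x by (intro LIMSEQ_le_const2) auto
    then show "t \<le> x" by simp
  next
    fix x n assume "t \<le> x"
    moreover have "0 < inverse (real (Suc n))" by simp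
    ultimately show "t - inverse (real (Suc n)) \<le> x" by linarith
  qed
  finally have ge: "a \<le> S t"
    by (rule LIMSEQ_le_const) (auto intro!: below)
  have "S t = a" if b: "b \<in> supp F" "t < b" for b
  proof -
    have "(\<lambda>n. prob {t + inverse (real (Suc n))..}) \<longlonglongrightarrow> prob (\<Union>n. {t + inverse (real (Suc n))..})"
      by (intro finite_Lim_measure_incseq incseq_SucI) (auto intro: le_imp_inverse_le)
    also have "(\<Union>n. {t + inverse (real (Suc n))..}) = {t<..}"
    proof safe
      fix x assume "t < x"
      then obtain n where "inverse (real (Suc n)) < x - t" using reals_Archimedean[of "x - t"] by auto
      then show "x \<in> (\<Union>n. {t + inverse (real (Suc n))..})" by (intro UN_I[of n]) auto
    next
      fix x n assume "t + inverse (real (Suc n)) \<le> x"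
      moreover have "0 < inverse (real (Suc n))" by simp
      ultimately show "t < x" by linarith
    qed
    finally have le: "prob {t<..} \<le> a"
      by (rule LIMSEQ_le_const2) (auto intro!: above)
    obtain f where f: "density_below F f"
      using valuation_distribution unfolding valuation_distribution_def by (elim conjE exE)
    have "ennreal (prob {t}) = (\<integral>\<^sup>+v. ennreal (f v) * indicator ({t} \<inter> supp F) v \<partial>lborel)"
      using supp_belowI[OF _ b] by (intro emeasure_density_supp[OF f]) auto
    also have "\<dots> = (\<integral>\<^sup>+v. 0 \<partial>(lborel :: real measure))"
      using AE_lborel_singleton[of t] by (intro nn_integral_cong_AE) (auto elim!: eventually_mono)
    finally have "prob {t} = 0" by (simp add: ennreal_eq_0_iff measure_le_0_iff)
    moreover have "S t = prob {t} + prob {t<..}"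
    proof -
      have "{t..} = {t} \<union> {t<..}" by auto
      then show ?thesis using finite_measure_Union[of "{t}" "{t<..}"] by simp
    qed
    ultimately show ?thesis using le ge by simp
  qed
  then show ?thesis using that r ge by blast
qed

lemma pareto_quantile_one: "0 < q \<Longrightarrow> pareto_quantile 1 q = 1 / q - 1"
  by (simp add: pareto_quantile_def powr_minus divide_inverse)

text \<open>The surcharge \<open>c\<close> is the point where a supporting line of \<open>1 / S\<close> at the price of acceptance
  probability \<open>a\<close> vanishes. It is non-negative because that price is at least the reserve.\<close>

lemma surcharge_exists:
  assumes reg: "lambda_regular 1 F" and a: "0 < a" "a < S (monopoly_reserve F)" and r: "0 < monopoly_reserve F"
  shows "\<exists>t c B. 0 \<le> t \<and> 0 \<le> c \<and> 0 \<le> B \<and> a \<le> S t \<and> (\<forall>x\<ge>c. (x - c) * S x \<le> B) \<and> c * a + B \<le> a * t"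
proof -
  let ?r = "monopoly_reserve F"
  obtain t where t: "?r \<le> t" "a \<le> S t" "(\<exists>b\<in>supp F. t < b) \<Longrightarrow> S t = a"
    using quantile_exists[of a ?r] a by auto
  have t0: "0 < t" using t r by linarith
  show ?thesis
  proof (cases "\<exists>b\<in>supp F. t < b")
    case False
    \<comment> \<open>Here t bounds the support from above: with surcharge t nothing remains to be
      earned, so c = t and B = 0.\<close>
    have "(x - t) * S x \<le> 0" if "t \<le> x" for x
    proof (cases "S x = 0")
      case S: False
      then have "0 < S x" using measure_nonneg[of F "{x..}"] by linarith
      then obtain y where "y \<in> supp F" "x \<le> y" by (rule supp_above)
      with False that have "x = t" by fastforce
      then show ?thesis by simp
    qed simp
    then show ?thesis using t t0 by (intro exI[of _ t] exI[of _ 0]) (auto simp: mult.commute)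
  next
    case True
    then obtain b where b: "b \<in> supp F" "t < b" by blast
    have St: "S t = a" using t(3) True by blast
    obtain s where s: "0 \<le> s" "\<And>u. 0 < S u \<Longrightarrow> pareto_quantile 1 (S t) + s * (u - t) \<le> pareto_quantile 1 (S u)"
      using supporting_line[OF reg _ b] by auto
    have line: "1 / a + s * (u - t) \<le> 1 / S u" if "0 < S u" for u
      using s(2)[OF that] that a by (simp add: pareto_quantile_one St)
    have rt: "?r < t" using a St t(1) by (cases "?r = t") auto
    \<comment> \<open>Revenue at t does not beat the reserve. Inserted into the supporting line at
      the reserve, this gives \<open>1 \<le> s * (t * a)\<close>, which is exactly the
      non-negativity of c.\<close>
    have "t * a \<le> ?r * S ?r" using monopoly_revenue[of t] t0 St by simp
    then have "1 / S ?r \<le> ?r / (t * a)" using a t0 by (simp add: field_simps)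
    then have "1 / a + s * (?r - t) \<le> ?r / (t * a)" using line[of ?r] a by simp
    then have "t * a * (1 / a + s * (?r - t)) \<le> t * a * (?r / (t * a))"
      using a t0 by (intro mult_left_mono) auto
    also have "\<dots> = ?r" using a t0 by simp
    also have "t * a * (1 / a + s * (?r - t)) = t + t * a * (s * (?r - t))"
      using a by (simp add: distrib_left)
    finally have "(t - ?r) * 1 \<le> (t - ?r) * (s * (t * a))" by (simp add: algebra_simps)
    then have sta: "1 \<le> s * (t * a)" using rt by (subst (asm) mult_le_cancel_left_pos) auto
    have s0: "0 < s" using sta s(1) by (cases "s = 0") auto
    define c where "c = t - 1 / (s * a)"
    have c: "0 \<le> c" using sta s0 a by (simp add: c_def field_simps)
    \<comment> \<open>The supporting line equals \<open>s * (x - c)\<close>; lying below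
      \<open>1 / S x\<close> it bounds the profit \<open>(x - c) * S x\<close> by
      \<open>1 / s\<close>. At t the bound is tight, so the certificate loses nothing.\<close>
    have "(x - c) * S x \<le> 1 / s" if "c \<le> x" for x
    proof (cases "S x = 0")
      case False
      then have Sx: "0 < S x" using measure_nonneg[of F "{x..}"] by linarith
      have "s * (x - c) = 1 / a + s * (x - t)" using s0 a by (simp add: c_def field_simps)
      then have "s * (x - c) \<le> 1 / S x" using line[OF Sx] by simp
      then show ?thesis using Sx s0 by (simp add: field_simps)
    qed (use s0 in simp)
    moreover have "c * a + 1 / s = a * t" using s0 a by (simp add: c_def field_simps)
    ultimately show ?thesis using c s0 t0 t(2)
      by (intro exI[of _ t] exI[of _ c] exI[of _ "1 / s"]) auto
  qed
qed

text \<open>A price \<open>p\<close> for the larger market together with a dual bound \<open>c * a + B\<close> on the optimal revenue per buyer.\<close>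

lemma price_certificate:
  assumes reg: "lambda_regular lam F" and lam: "0 \<le> lam" "lam \<le> 1"
    and \<mu>: "0 < \<mu>" "\<mu> \<le> a" "\<mu> < 1" and G: "0 < G" "G \<le> 1"
    and gap: "\<And>q. 0 < q \<Longrightarrow> q < \<mu> \<Longrightarrow> G * (q * pareto_quantile lam q) \<le> a * pareto_quantile lam \<mu>"
  shows "\<exists>p c B. 0 \<le> p \<and> 0 \<le> c \<and> 0 \<le> B \<and> \<mu> \<le> S p \<and> (\<forall>x\<ge>c. (x - c) * S x \<le> B) \<and> G * (c * a + B) \<le> a * p"
proof -
  let ?r = "monopoly_reserve F"
  have r0: "0 \<le> ?r" using supp_nonneg monopoly_reserve_in_supp by blast
  have a: "0 < a" using \<mu> by simp
  \<comment> \<open>No revenue at all; demand at the reserve within supply, where c = 0 and the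
    monopoly revenue are the dual bound; demand beyond supply, where a surcharge is needed.\<close>
  consider "?r = 0 \<or> S ?r = 0" | "0 < ?r" "0 < S ?r" "S ?r \<le> a" | "0 < ?r" "a < S ?r"
    using r0 measure_nonneg[of F "{?r..}"] by linarith
  then show ?thesis
  proof cases
    case 1
    then have "\<forall>x\<ge>0. (x - 0) * S x \<le> 0" using monopoly_revenue by auto
    then show ?thesis using \<mu> S_nonpos[of 0]
      by (intro exI[of _ 0]) auto
  next
    case 2
    have rev: "\<forall>x\<ge>0. (x - 0) * S x \<le> ?r * S ?r" using monopoly_revenue by simp
    show ?thesis
    proof (cases "\<mu> \<le> S ?r")
      case True
      have "G * (?r * S ?r) \<le> 1 * (?r * a)" using 2 G by (intro mult_mono) auto
      then show ?thesis using True 2 rev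
        by (intro exI[of _ ?r] exI[of _ 0] exI[of _ "?r * S ?r"]) (auto simp: mult.commute)
    next
      case False
      let ?L = "pareto_quantile lam"
      have L: "0 < ?L \<mu>" "?L \<mu> < ?L (S ?r)"
        using False 2 \<mu> lam by (auto intro: pareto_quantile_pos pareto_quantile_strict_antimono)
      \<comment> \<open>The price at which the chord of \<open>L (S x)\<close> from 0 to the reserve
        has height \<open>L \<mu>\<close>. The curve lies below its chord, so p is accepted with
        probability at least \<mu>, and \<open>gap\<close> at \<open>q = S r\<close> compares the
        revenues.\<close>
      define p where "p = ?r * (?L \<mu> / ?L (S ?r))"
      have "?L \<mu> / ?L (S ?r) < 1" using L by simp
      then have p: "0 \<le> p" "p < ?r" using L 2 mult_strict_left_mono[of "?L \<mu> / ?L (S ?r)" 1 ?r]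
        by (auto simp: p_def)
      have "?r * ?L (S p) \<le> p * ?L (S ?r)"
        by (rule pareto_quantile_star_shaped[OF reg lam(1) p 2(2)])
      also have "\<dots> = ?r * ?L \<mu>" using L by (simp add: p_def)
      finally have Lp: "?L (S p) \<le> ?L \<mu>" using 2 by simp
      have "0 < S p" using 2 S_antimono[of p ?r] p by linarith
      then have Sp: "\<mu> \<le> S p" using Lp pareto_quantile_strict_antimono[OF lam(1), of "S p" \<mu>]
        by (cases "\<mu> \<le> S p") auto
      have "G * (S ?r * ?L (S ?r)) \<le> a * ?L \<mu>" using gap[of "S ?r"] 2 False by simp
      then have "G * S ?r \<le> a * (?L \<mu> / ?L (S ?r))" using L by (simp add: field_simps)
      then have "?r * (G * S ?r) \<le> ?r * (a * (?L \<mu> / ?L (S ?r)))" using 2 by (intro mult_left_mono) auto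
      then have "G * (0 * a + ?r * S ?r) \<le> a * p" by (simp add: p_def mult_ac)
      then show ?thesis using Sp p 2 rev
        by (intro exI[of _ p] exI[of _ 0] exI[of _ "?r * S ?r"]) auto
    qed
  next
    case 3
    obtain t c B where tcB: "0 \<le> t" "0 \<le> c" "0 \<le> B" "a \<le> S t" "\<forall>x\<ge>c. (x - c) * S x \<le> B" "c * a + B \<le> a * t"
      using surcharge_exists[OF lambda_regular_mono[OF reg lam(2)] a 3(2,1)] by blast
    have "G * (c * a + B) \<le> 1 * (c * a + B)" using G tcB a by (intro mult_right_mono) auto
    then show ?thesis using tcB \<mu> by (intro exI[of _ t] exI[of _ c] exI[of _ B]) auto
  qed
qed

end

subsection \<open>The generalized Pareto revenue curve\<close>

lemma threshold_cases:
  assumes "0 < lam" "lam < 1" "0 < q"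
  shows "q \<le> threshold lam \<longleftrightarrow> q powr lam \<le> 1 - lam"
proof -
  have "threshold lam powr lam = 1 - lam" using assms by (simp add: threshold_def powr_powr)
  moreover have "0 < threshold lam" using assms by (simp add: threshold_def)
  ultimately show ?thesis
    using assms powr_mono2[of lam q "threshold lam"] powr_less_mono2[of lam "threshold lam" q]
    by (auto simp: not_le[symmetric] simp del: not_le)
qed

lemma threshold_nonneg: "0 \<le> threshold lam"
  by (simp add: threshold_def)

lemma threshold_pos: "lam < 1 \<Longrightarrow> 0 < threshold lam"
  by (simp add: threshold_def)

lemma reg_factor_pos: "0 \<le> lam \<Longrightarrow> lam \<le> 1 \<Longrightarrow> 0 < reg_factor lam"
  by (simp add: reg_factor_def)

lemma pareto_revenue_deriv:
  assumes "0 < q"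
  shows "((\<lambda>q. q * pareto_quantile lam q) has_real_derivative pareto_quantile lam q - q powr (- lam)) (at q)"
proof (cases "lam = 0")
  case True
  then show ?thesis using assms unfolding pareto_quantile_def
    by (auto intro!: derivative_eq_intros)
next
  case False
  have "q * q powr (- lam - 1) = q powr (- lam)" using assms by (simp add: powr_mult_base)
  then show ?thesis using assms False unfolding pareto_quantile_def
    by (auto intro!: derivative_eq_intros simp: field_simps)
qed

text \<open>The origin of the threshold: it is the zero of the marginal revenue, whose sign is that
  of \<open>1 - lam - q powr lam\<close> for lam strictly between 0 and 1. For lam = 0 the marginal
  revenue is \<open>- ln q - 1\<close>, for lam = 1 it is -1.\<close>

lemma pareto_marginal_revenue:
  assumes lam: "0 \<le> lam" "lam \<le> 1" and q: "0 < q"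
  shows "q \<le> threshold lam \<Longrightarrow> 0 \<le> pareto_quantile lam q - q powr (- lam)"
    and "threshold lam < q \<Longrightarrow> pareto_quantile lam q - q powr (- lam) < 0"
proof -
  consider "lam = 0" | "lam = 1" | "0 < lam" "lam < 1" using lam by linarith
  then have "(q \<le> threshold lam \<longrightarrow> 0 \<le> pareto_quantile lam q - q powr (- lam)) \<and>
    (threshold lam < q \<longrightarrow> pareto_quantile lam q - q powr (- lam) < 0)"
  proof cases
    case 1
    have "q \<le> exp (- 1) \<longleftrightarrow> ln q \<le> - 1"
      using q by (metis exp_ln exp_le_cancel_iff)
    then show ?thesis using 1 q by (auto simp: pareto_quantile_def threshold_def)
  next
    case 2
    then show ?thesis using q by (simp add: pareto_quantile_def threshold_def)
  next
    case 3
    have "lam * (pareto_quantile lam q - q powr (- lam)) = (1 - lam - q powr lam) / q powr lam"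
      using 3 q by (simp add: pareto_quantile_def powr_minus field_simps)
    moreover have "0 < q powr lam" using q by simp
    ultimately show ?thesis using 3 q threshold_cases[OF 3 q]
      by (smt (verit) divide_neg_pos divide_nonneg_pos mult_less_0_iff zero_le_mult_iff)
  qed
  then show "q \<le> threshold lam \<Longrightarrow> 0 \<le> pareto_quantile lam q - q powr (- lam)"
    and "threshold lam < q \<Longrightarrow> pareto_quantile lam q - q powr (- lam) < 0" by auto
qed

lemma pareto_revenue_mono:
  assumes lam: "0 \<le> lam" "lam \<le> 1" and q: "0 < q" "q \<le> q'" "q' \<le> threshold lam"
  shows "q * pareto_quantile lam q \<le> q' * pareto_quantile lam q'"
  using q(2)
proof (rule DERIV_nonneg_imp_nondecreasing)
  fix x assume "q \<le> x" "x \<le> q'"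
  then show "\<exists>y. ((\<lambda>q. q * pareto_quantile lam q) has_real_derivative y) (at x) \<and> 0 \<le> y"
    using q pareto_revenue_deriv[of x lam] pareto_marginal_revenue(1)[OF lam, of x] by force
qed

lemma pareto_revenue_strict_antimono:
  assumes lam: "0 \<le> lam" "lam \<le> 1" and q: "0 < q" "threshold lam \<le> q" "q < q'"
  shows "q' * pareto_quantile lam q' < q * pareto_quantile lam q"
  using q(3)
proof (rule DERIV_neg_imp_decreasing_open)
  fix x assume "q < x" "x < q'"
  then show "\<exists>y. ((\<lambda>q. q * pareto_quantile lam q) has_real_derivative y) (at x) \<and> y < 0"
    using q pareto_revenue_deriv[of x lam] pareto_marginal_revenue(2)[OF lam, of x] by force
next
  show "continuous_on {q..q'} (\<lambda>q. q * pareto_quantile lam q)"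
    using q DERIV_isCont[OF pareto_revenue_deriv] by (intro continuous_at_imp_continuous_on) auto
qed

lemma pareto_revenue_threshold:
  assumes "0 \<le> lam" "lam < 1"
  shows "threshold lam * pareto_quantile lam (threshold lam) = reg_factor lam"
proof (cases "lam = 0")
  case False
  have "threshold lam * pareto_quantile lam (threshold lam) = (1 - lam) powr (1 / lam) * (inverse (1 - lam) - 1) / lam"
    using assms False by (simp add: threshold_def pareto_quantile_def powr_powr powr_minus)
  also have "\<dots> = (1 - lam) powr (1 / lam) / (1 - lam)"
    using assms False by (simp add: field_simps)
  also have "\<dots> = (1 - lam) powr (1 / lam - 1)" using assms by (simp add: powr_diff)
  also have "1 / lam - 1 = (1 - lam) / lam" using assms False by (simp add: field_simps)
  finally show ?thesis using assms False by (simp add: reg_factor_def)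
qed (simp add: threshold_def pareto_quantile_def reg_factor_def)

lemma pareto_revenue_le:
  assumes lam: "0 \<le> lam" "lam \<le> 1" and q: "0 < q"
  shows "q * pareto_quantile lam q \<le> reg_factor lam"
proof (cases "lam = 1")
  case True
  then show ?thesis using q by (simp add: pareto_quantile_def reg_factor_def powr_minus right_diff_distrib)
next
  case False
  then have lam1: "lam < 1" using lam by simp
  show ?thesis
  proof (cases "q \<le> threshold lam")
    case True
    then show ?thesis using pareto_revenue_mono[OF lam q True order_refl] pareto_revenue_threshold[OF lam(1) lam1] by simp
  next
    case False
    then show ?thesis using pareto_revenue_strict_antimono[OF lam threshold_pos[OF lam1], of q]
        pareto_revenue_threshold[OF lam(1) lam1] by auto
  qed
qed

text \<open>The limit is taken from the right because \<theta> must stay above the threshold. For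
  lam = 1 the threshold is 0 and the supremum 1 of \<open>1 - q\<close> is only approached.\<close>

lemma pareto_revenue_near_sup:
  assumes lam: "0 \<le> lam" "lam \<le> 1" and c: "c < reg_factor lam" and \<alpha>: "threshold lam < \<alpha>"
  obtains \<theta> where "threshold lam < \<theta>" "\<theta> < \<alpha>" "c < \<theta> * pareto_quantile lam \<theta>"
proof -
  have "((\<lambda>q. q * pareto_quantile lam q) \<longlongrightarrow> reg_factor lam) (at_right (threshold lam))"
  proof (cases "lam = 1")
    case True
    have "((\<lambda>q::real. 1 - q) \<longlongrightarrow> 1 - 0) (at_right 0)" by (intro tendsto_intros)
    moreover have "\<forall>\<^sub>F q::real in at_right 0. 1 - q = q * pareto_quantile lam q"
      using True by (auto simp: eventually_at_filter pareto_quantile_def powr_minus right_diff_distrib)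
    ultimately have "((\<lambda>q. q * pareto_quantile lam q) \<longlongrightarrow> 1 - 0) (at_right 0)"
      by (rule Lim_transform_eventually)
    then show ?thesis using True by (simp add: threshold_def reg_factor_def)
  next
    case False
    then have lam1: "lam < 1" using lam by simp
    have "isCont (\<lambda>q. q * pareto_quantile lam q) (threshold lam)"
      by (rule DERIV_isCont[OF pareto_revenue_deriv[OF threshold_pos[OF lam1]]])
    then show ?thesis
      unfolding continuous_at pareto_revenue_threshold[OF lam(1) lam1]
      by (rule tendsto_mono[rotated]) (simp add: at_le)
  qed
  then have "\<forall>\<^sub>F q in at_right (threshold lam). c < q * pareto_quantile lam q"
    using c by (rule order_tendstoD(1))
  moreover have "\<forall>\<^sub>F q in at_right (threshold lam). q \<in> {threshold lam<..<\<alpha>}"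
    using \<alpha> by (rule eventually_at_right_real)
  ultimately have "\<forall>\<^sub>F q in at_right (threshold lam). c < q * pareto_quantile lam q \<and> q \<in> {threshold lam<..<\<alpha>}"
    by (rule eventually_conj)
  then show ?thesis using that eventually_happens'[OF trivial_limit_at_right_real] by fastforce
qed

lemma growth_pos:
  assumes "0 \<le> lam" "lam \<le> 1" "0 < \<alpha>" "0 < \<Gamma>"
  shows "0 < growth lam \<alpha> \<Gamma>"
proof -
  have "0 \<le> lam * \<Gamma> / \<alpha> * reg_factor lam"
    using assms reg_factor_pos[of lam] by simp
  then have "0 < (lam * \<Gamma> / \<alpha> * reg_factor lam + 1) powr (1 / lam)" by simp
  then show ?thesis using assms by (simp add: growth_def)
qed

text \<open>\<open>growth\<close> is the relative market size g that solves
  \<open>\<alpha> * L (\<alpha> / g) = \<Gamma> * reg_factor lam\<close>, that is, where the worst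
  ratio of revenues equals \<Gamma>.\<close>

lemma pareto_quantile_growth:
  assumes "0 \<le> lam" "lam \<le> 1" "0 < \<alpha>" "0 < \<Gamma>"
  shows "\<alpha> * pareto_quantile lam (\<alpha> / growth lam \<alpha> \<Gamma>) = \<Gamma> * reg_factor lam"
proof (cases "lam = 0")
  case True
  then show ?thesis using assms
    by (simp add: growth_def pareto_quantile_def reg_factor_def ln_div exp_minus field_simps)
next
  case False
  define X where "X = lam * \<Gamma> / \<alpha> * reg_factor lam + 1"
  have X: "0 < X" using assms reg_factor_pos[of lam] by (auto simp: X_def intro!: add_nonneg_pos)
  have "\<alpha> / growth lam \<alpha> \<Gamma> = X powr (- 1 / lam)"
  proof -
    have "growth lam \<alpha> \<Gamma> = \<alpha> * X powr (1 / lam)"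
      using False by (simp only: growth_def X_def if_False)
    then show ?thesis using assms X by (simp add: powr_minus_divide)
  qed
  then have "(\<alpha> / growth lam \<alpha> \<Gamma>) powr (- lam) = X"
    using X False by (simp add: powr_powr)
  then show ?thesis using False assms by (simp add: pareto_quantile_def X_def)
qed

text \<open>Leaves room for \<theta> below \<alpha>. At equality
  \<open>\<alpha> * L \<alpha>\<close> is already the full factor, so the ratio \<Gamma> < 1 would
  be met by a market smaller than the original one.\<close>

lemma threshold_less_if_growth:
  assumes lam: "0 \<le> lam" "lam \<le> 1" and \<alpha>: "0 < \<alpha>" "threshold lam \<le> \<alpha>" and \<Gamma>: "0 < \<Gamma>" "\<Gamma> < 1"
    and growth: "1 < growth lam \<alpha> \<Gamma>"
  shows "threshold lam < \<alpha>"
proof (rule ccontr)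
  assume "\<not> threshold lam < \<alpha>"
  then have eq: "threshold lam = \<alpha>" using \<alpha> by simp
  then have lam1: "lam < 1" using \<alpha> lam by (cases "lam = 1") (auto simp: threshold_def)
  have "\<alpha> * pareto_quantile lam (\<alpha> / growth lam \<alpha> \<Gamma>) = \<Gamma> * (\<alpha> * pareto_quantile lam \<alpha>)"
    using pareto_quantile_growth[OF lam \<alpha>(1) \<Gamma>(1)] pareto_revenue_threshold[OF lam(1) lam1] eq by simp
  moreover have "0 < reg_factor lam" "\<alpha> * pareto_quantile lam \<alpha> = reg_factor lam"
    using reg_factor_pos lam pareto_revenue_threshold[OF lam(1) lam1] eq by auto
  ultimately have "\<alpha> * pareto_quantile lam (\<alpha> / growth lam \<alpha> \<Gamma>) < \<alpha> * pareto_quantile lam \<alpha>"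
    using \<Gamma> by simp
  then have "pareto_quantile lam (\<alpha> / growth lam \<alpha> \<Gamma>) < pareto_quantile lam \<alpha>" using \<alpha> by simp
  moreover have "\<alpha> / growth lam \<alpha> \<Gamma> \<le> \<alpha>" using growth \<alpha> by (simp add: field_simps)
  ultimately show False
    using pareto_quantile_antimono[OF lam(1), of "\<alpha> / growth lam \<alpha> \<Gamma>" \<alpha>] growth \<alpha> by simp
qed

subsection \<open>Truncated generalized Pareto distributions\<close>

text \<open>The worst case. Selling with probability \<open>\<theta>\<close> slightly above the threshold is nearly optimal for the
  generalized Pareto distribution, and an atom at the corresponding price makes that price the unique
  reserve. Without the atom there is no reserve when \<open>lam = 1\<close>.\<close>

locale truncated_pareto =
  fixes lam \<theta> :: real
  assumes lam: "0 \<le> lam" "lam \<le> 1" and \<theta>: "threshold lam < \<theta>" "\<theta> < 1"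
begin

definition survival :: "real \<Rightarrow> real" where
  "survival x = (if lam = 0 then exp (- x) else (1 + lam * x) powr (- 1 / lam))"

definition pareto_density :: "real \<Rightarrow> real" where
  "pareto_density x = survival x / (1 + lam * x) * indicator {0..} x"

definition pareto :: "real measure" where
  "pareto = density lborel (\<lambda>x. ennreal (pareto_density x))"

definition cap :: real where
  "cap = pareto_quantile lam \<theta>"

definition truncated :: "real measure" where
  "truncated = distr pareto borel (\<lambda>x. min x cap)"

lemma \<theta>_pos: "0 < \<theta>"
  using \<theta>(1) threshold_nonneg[of lam] by linarith

lemma base_pos: "0 \<le> x \<Longrightarrow> 0 < 1 + lam * x"
  using lam by (simp add: add_pos_nonneg)

lemma survival_pos: "0 \<le> x \<Longrightarrow> 0 < survival x"
  using base_pos[of x] by (simp add: survival_def)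

lemma survival_0: "survival 0 = 1"
  by (simp add: survival_def)

lemma survival_quantile: "0 < q \<Longrightarrow> survival (pareto_quantile lam q) = q"
  by (simp add: survival_def pareto_quantile_def powr_powr)

lemma quantile_survival: "0 \<le> x \<Longrightarrow> pareto_quantile lam (survival x) = x"
  using base_pos[of x] by (simp add: survival_def pareto_quantile_def powr_powr)

lemma survival_strict_antimono:
  assumes "0 \<le> x" "x < y"
  shows "survival y < survival x"
proof (rule ccontr)
  assume "\<not> survival y < survival x"
  then have "pareto_quantile lam (survival y) \<le> pareto_quantile lam (survival x)"
    using survival_pos[of x] assms lam by (intro pareto_quantile_antimono) auto
  then show False using assms by (simp add: quantile_survival)
qed

lemma survival_deriv:
  assumes "0 \<le> x"
  shows "(survival has_real_derivative - (survival x / (1 + lam * x))) (at x)"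
proof (cases "lam = 0")
  case True
  have "survival = (\<lambda>x. exp (- x))" by (rule ext, unfold survival_def) (simp add: True)
  then show ?thesis using True by (auto intro!: derivative_eq_intros)
next
  case False
  then have eq: "survival = (\<lambda>x. (1 + lam * x) powr (- 1 / lam))" by (simp add: survival_def fun_eq_iff)
  have "(1 + lam * x) powr (- 1 / lam - 1) = (1 + lam * x) powr (- 1 / lam) / (1 + lam * x)"
    using base_pos[OF assms] by (simp add: powr_diff)
  then show ?thesis unfolding eq using base_pos[OF assms] False
    by (auto intro!: derivative_eq_intros simp: field_simps)
qed

lemma survival_tendsto: "(survival \<longlongrightarrow> 0) at_top"
proof (cases "lam = 0")
  case True
  have "survival = (\<lambda>x. exp (- x))" by (rule ext, unfold survival_def) (simp add: True)
  moreover have "((\<lambda>x::real. exp (- x)) \<longlongrightarrow> 0) at_top" by real_asymp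
  ultimately show ?thesis by simp
next
  case False
  then have eq: "survival = (\<lambda>x. (1 + lam * x) powr (- 1 / lam))" by (simp add: survival_def fun_eq_iff)
  have "0 < lam" using lam False by simp
  then have "((\<lambda>x. (1 + lam * x) powr (- 1 / lam)) \<longlongrightarrow> 0) at_top" by real_asymp
  then show ?thesis by (simp only: eq)
qed

lemma measurable_survival [measurable]: "survival \<in> borel_measurable borel"
  unfolding survival_def by measurable

lemma measurable_pareto_density [measurable]: "pareto_density \<in> borel_measurable borel"
  unfolding pareto_density_def by measurable

lemma pareto_density_nonneg: "0 \<le> pareto_density x"
  using survival_pos[of x] base_pos[of x] by (cases "0 \<le> x") (simp_all add: pareto_density_def)

lemma sets_pareto [simp]: "sets pareto = sets borel" and space_pareto [simp]: "space pareto = UNIV"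
  by (simp_all add: pareto_def)

lemma emeasure_pareto_atLeast:
  assumes "0 \<le> a"
  shows "emeasure pareto {a..} = ennreal (survival a)"
proof -
  have "emeasure pareto {a..} = (\<integral>\<^sup>+x. ennreal (pareto_density x) * indicator {a..} x \<partial>lborel)"
    by (simp add: pareto_def emeasure_density)
  also have "\<dots> = (\<integral>\<^sup>+x. ennreal (survival x / (1 + lam * x)) * indicator {a..} x \<partial>lborel)"
    using assms by (intro nn_integral_cong) (auto simp: pareto_density_def indicator_def)
  also have "\<dots> = ennreal (0 - (- survival a))"
  proof (rule nn_integral_FTC_atLeast)
    fix x assume "a \<le> x"
    then have x: "0 \<le> x" using assms by simp
    show "((\<lambda>x. - survival x) has_real_derivative survival x / (1 + lam * x)) (at x)"
      using DERIV_minus[OF survival_deriv[OF x]] by simp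
    show "0 \<le> survival x / (1 + lam * x)" using survival_pos[OF x] base_pos[OF x] by simp
  next
    show "((\<lambda>x. - survival x) \<longlongrightarrow> 0) at_top" using tendsto_minus[OF survival_tendsto] by simp
  qed simp
  finally show ?thesis by simp
qed

lemma measure_pareto_atLeast: "0 \<le> a \<Longrightarrow> measure pareto {a..} = survival a"
  using survival_pos[of a] by (simp add: measure_def emeasure_pareto_atLeast)

lemma prob_space_pareto: "prob_space pareto"
proof
  have "emeasure pareto {..<0} = (\<integral>\<^sup>+x. 0 \<partial>(lborel :: real measure))"
    by (simp add: pareto_def emeasure_density del: nn_integral_const)
      (intro nn_integral_cong, simp add: pareto_density_def indicator_def)
  then have "emeasure pareto {..<0} = 0" by simp
  moreover have "emeasure pareto {0..} = 1" by (simp add: emeasure_pareto_atLeast survival_0)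
  moreover have "emeasure pareto ({..<0} \<union> {0..}) = emeasure pareto {..<0} + emeasure pareto {0..}"
    by (intro plus_emeasure[symmetric]) auto
  moreover have "{..<0} \<union> {0..} = (UNIV :: real set)" by auto
  ultimately show "emeasure pareto (space pareto) = 1" by simp
qed

lemma cap_pos: "0 < cap"
  using \<theta> \<theta>_pos lam by (simp add: cap_def pareto_quantile_pos)

lemma survival_cap: "survival cap = \<theta>"
  by (simp add: cap_def survival_quantile \<theta>_pos)

lemma measurable_truncation: "(\<lambda>x. min x cap) \<in> measurable pareto borel"
  by (simp add: measurable_cong_sets[OF sets_pareto refl])

sublocale prob_space truncated
  unfolding truncated_def by (rule prob_space.prob_space_distr[OF prob_space_pareto measurable_truncation])

lemma sets_truncated [simp]: "sets truncated = sets borel" and space_truncated [simp]: "space truncated = UNIV"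
  by (simp_all add: truncated_def)

lemma prob_truncated: "A \<in> sets borel \<Longrightarrow> prob A = measure pareto {x. min x cap \<in> A}"
  using measurable_truncation by (simp add: truncated_def measure_distr vimage_def)

lemma prob_atLeast:
  assumes "0 \<le> x" "x \<le> cap"
  shows "prob {x..} = survival x"
proof -
  have "{y. min y cap \<in> {x..}} = {x..}" using assms by auto
  then show ?thesis using assms prob_truncated[of "{x..}"] measure_pareto_atLeast[of x] by (simp only: borel_closed closed_atLeast)
qed

lemma prob_greater_cap: "prob {cap<..} = 0"
  by (simp add: prob_truncated)

lemma prob_negative: "prob {..<0} = 0"
proof -
  have "space truncated - {0..} = {..<0}" by auto
  then show ?thesis using prob_compl[of "{0..}"] cap_pos prob_atLeast[of 0] by (simp add: survival_0)
qed

text \<open>In terms of \<open>q = survival p\<close> the revenue is \<open>q * L q\<close>,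
  strictly decreasing beyond the threshold; a price below the cap has q > \<theta>.\<close>

lemma revenue_less_cap:
  assumes "0 \<le> p" "p < cap"
  shows "p * prob {p..} < cap * prob {cap..}"
proof -
  have "\<theta> < survival p" using survival_strict_antimono[OF assms] survival_cap by simp
  then have "survival p * pareto_quantile lam (survival p) < \<theta> * pareto_quantile lam \<theta>"
    using \<theta> \<theta>_pos by (intro pareto_revenue_strict_antimono lam) auto
  then show ?thesis using assms cap_pos
    by (simp add: quantile_survival prob_atLeast survival_cap mult.commute flip: cap_def)
qed

lemma supp_truncated: "supp truncated = {0..cap}"
proof safe
  fix x assume x: "x \<in> supp truncated"
  show "x \<in> {0..cap}"
  proof (rule ccontr)
    assume "x \<notin> {0..cap}"
    then have "x \<in> {..<0} \<or> x \<in> {cap<..}" by auto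
    then show False using x prob_greater_cap prob_negative
      unfolding supp_def by (metis (mono_tags, lifting) less_irrefl mem_Collect_eq open_greaterThan open_lessThan)
  qed
next
  fix x assume x: "x \<in> {0..cap}"
  show "x \<in> supp truncated" unfolding supp_def
  proof safe
    fix U :: "real set" assume U: "open U" "x \<in> U"
    show "0 < prob U"
    proof (cases "x = cap")
      case True
      have "{y. min y cap \<in> {cap}} = {cap..}" by auto
      then have "prob {cap} = measure pareto {cap..}"
        using prob_truncated[of "{cap}"] by (simp only: borel_closed closed_singleton)
      then have "prob {cap} = \<theta>" using cap_pos by (simp add: measure_pareto_atLeast survival_cap)
      moreover have "prob {cap} \<le> prob U" using U True by (intro finite_measure_mono) auto
      ultimately show ?thesis using \<theta>_pos by simp
    next
      case False
      then have "x < cap" using x by simp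
      obtain e where e: "0 < e" "ball x e \<subseteq> U" using U openE by blast
      define y where "y = min (x + e) cap"
      have y: "x < y" "y \<le> cap" "{x..<y} \<subseteq> U"
        using e \<open>x < cap\<close> by (auto simp: y_def ball_def dist_real_def subset_iff)
      have "{x..} - {y..} = {x..<y}" by auto
      then have "prob {x..<y} = survival x - survival y"
        using finite_measure_Diff[of "{x..}" "{y..}"] x y by (simp add: prob_atLeast)
      moreover have "survival y < survival x" using x y by (intro survival_strict_antimono) auto
      moreover have "prob {x..<y} \<le> prob U" using U y by (intro finite_measure_mono) auto
      ultimately show ?thesis by simp
    qed
  qed
qed

lemma supp_below_truncated: "supp_below truncated = {0..<cap}"
  using cap_pos by (auto simp: supp_below_def supp_truncated intro!: bexI[of _ cap])

lemma density_below_truncated: "density_below truncated pareto_density"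
  unfolding density_below_def supp_below_truncated
proof (intro conjI ballI impI allI)
  fix A :: "real set" assume A: "A \<in> sets borel" "A \<subseteq> {0..<cap}"
  then have "{x. min x cap \<in> A} = A" by (auto simp: min_def subset_iff split: if_splits)
  then have "emeasure truncated A = emeasure pareto A"
    using A measurable_truncation by (simp add: truncated_def emeasure_distr vimage_def)
  also have "\<dots> = (\<integral>\<^sup>+v\<in>A. ennreal (pareto_density v) \<partial>lborel)"
    using A by (simp add: pareto_def emeasure_density)
  finally show "emeasure truncated A = (\<integral>\<^sup>+v\<in>A. ennreal (pareto_density v) \<partial>lborel)" .
qed (simp_all add: pareto_density_nonneg)

lemma cdf_lt_truncated: "1 - cdf_lt truncated v = prob {v..}"
proof -
  have "{v..} = space truncated - {..<v}" by auto
  then show ?thesis using prob_compl[of "{..<v}"] by (simp add: cdf_lt_def)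
qed

lemma is_monopoly_reserve_truncated: "is_monopoly_reserve truncated r \<longleftrightarrow> r = cap"
proof
  assume r: "is_monopoly_reserve truncated r"
  then have "cap * prob {cap..} \<le> r * prob {r..}" "0 \<le> r" "r \<le> cap"
    using cap_pos by (auto simp: is_monopoly_reserve_def cdf_lt_truncated supp_truncated)
  then show "r = cap" using revenue_less_cap[of r] by (cases "r = cap") auto
next
  assume "r = cap"
  moreover have "p * prob {p..} \<le> cap * prob {cap..}" if "0 \<le> p" for p
  proof -
    consider "p < cap" | "p = cap" | "cap < p" by linarith
    then show ?thesis
    proof cases
      case 3
      then have "prob {p..} \<le> prob {cap<..}" by (intro finite_measure_mono) auto
      then have "prob {p..} = 0" using prob_greater_cap measure_nonneg[of truncated "{p..}"] by linarith
      then show ?thesis using cap_pos by simp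
    qed (use that revenue_less_cap[of p] in auto)
  qed
  ultimately show "is_monopoly_reserve truncated r"
    using cap_pos by (simp add: is_monopoly_reserve_def cdf_lt_truncated supp_truncated)
qed

lemma monopoly_reserve_truncated: "monopoly_reserve truncated = cap"
  unfolding monopoly_reserve_def is_monopoly_reserve_truncated by simp

lemma truncated_le_cap: "AE v in truncated. v \<le> cap"
proof -
  have "{cap<..} \<in> null_sets truncated" using prob_greater_cap by (intro null_setsI) (auto simp: emeasure_eq_measure)
  then show ?thesis by (rule AE_I') auto
qed

lemma truncated_nonneg: "AE v in truncated. 0 \<le> v"
proof -
  have "{..<0} \<in> null_sets truncated" using prob_negative by (intro null_setsI) (auto simp: emeasure_eq_measure)
  then show ?thesis by (rule AE_I') auto
qed

text \<open>The inverse hazard rate is \<open>1 + lam * v\<close>, so the virtual value is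
  constantly -1 below the atom.\<close>

lemma lambda_regular_truncated: "lambda_regular lam truncated"
  unfolding lambda_regular_def
proof (intro exI conjI)
  have "ereal (lam * v) - ereal (1 - cdf_lt truncated v) / ereal (pareto_density v) = - 1"
    if "v \<in> {0..<cap}" for v
  proof -
    have "1 - cdf_lt truncated v = survival v" using that by (simp add: cdf_lt_truncated prob_atLeast)
    moreover have "pareto_density v = survival v / (1 + lam * v)" using that by (simp add: pareto_density_def)
    ultimately show ?thesis using survival_pos[of v] base_pos[of v] that
      by (simp add: one_ereal_def)
  qed
  then show "mono_on (supp_below truncated) (\<lambda>v. ereal (lam * v) - ereal (1 - cdf_lt truncated v) / ereal (pareto_density v))"
    unfolding supp_below_truncated by (intro mono_onI) simp
qed (rule density_below_truncated)

lemma truncated_in_lambda_Reg: "truncated \<in> lambda_Reg lam"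
proof -
  have "\<exists>f. density_below truncated f" by (intro exI[of _ pareto_density] density_below_truncated)
  then have "valuation_distribution truncated"
    unfolding valuation_distribution_def is_monopoly_reserve_truncated supp_truncated
    using prob_space_axioms truncated_nonneg by (intro conjI) (simp_all add: is_interval_cc)
  then show ?thesis using lambda_regular_truncated by (simp add: lambda_Reg_def)
qed

lemma prob_quantile: "\<theta> \<le> \<sigma> \<Longrightarrow> \<sigma> \<le> 1 \<Longrightarrow> prob {pareto_quantile lam \<sigma>..} = \<sigma>"
  using \<theta>_pos lam
  by (subst prob_atLeast) (auto simp: cap_def survival_quantile intro: pareto_quantile_nonneg pareto_quantile_antimono)

end

subsection \<open>Asymptotic competition complexity\<close>

lemma CC_le:
  assumes "\<And>F. F \<in> \<F> \<Longrightarrow> ennreal \<Gamma> * Rev_OPT m n F \<le> Rev_VCG m (n + k) F"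
  shows "CC m n \<F> \<Gamma> \<le> enat k"
  unfolding CC_def using assms by (intro Inf_lower) blast

text \<open>A finite infimum in \<open>enat\<close> is attained by some k; an infinite one exceeds
  every bound.\<close>

lemma CC_ge:
  assumes "\<And>k. (\<And>F. F \<in> \<F> \<Longrightarrow> ennreal \<Gamma> * Rev_OPT m n F \<le> Rev_VCG m (n + k) F) \<Longrightarrow> c \<le> real k"
  shows "ereal c \<le> ereal_of_enat (CC m n \<F> \<Gamma>)"
proof (cases "CC m n \<F> \<Gamma>")
  case (enat k)
  define X where "X = {enat k | k. \<forall>F\<in>\<F>. Rev_VCG m (n + k) F \<ge> ennreal \<Gamma> * Rev_OPT m n F}"
  have Inf: "Inf X = enat k" using enat by (simp add: CC_def X_def)
  then have "X \<noteq> {}" by (auto simp: Inf_enat_def)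
  then have "Inf X \<in> X" by (auto simp: Inf_enat_def intro: LeastI)
  then have "c \<le> real k" unfolding Inf by (intro assms) (auto simp: X_def)
  then show ?thesis using enat by simp
qed simp

lemma exp_decay_antimono: "exp (- 2 * real (n + k) * d\<^sup>2) \<le> exp (- 2 * real n * (d::real)\<^sup>2)"
proof -
  have "- 2 * real n * d\<^sup>2 = - 2 * real (n + k) * d\<^sup>2 + 2 * (real k * d\<^sup>2)" by (simp add: algebra_simps)
  moreover have "0 \<le> real k * d\<^sup>2" by simp
  ultimately have "- 2 * real (n + k) * d\<^sup>2 \<le> - 2 * real n * d\<^sup>2" by linarith
  then show ?thesis by (rule exp_le_cancel_iff[THEN iffD2])
qed

lemma CC_ratio_upper:
  fixes lam \<alpha> \<Gamma> \<epsilon> :: real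
  assumes lam: "0 \<le> lam" "lam \<le> 1" and \<alpha>: "0 < \<alpha>" "\<alpha> \<le> 1" and \<Gamma>: "0 < \<Gamma>" "\<Gamma> < 1" and \<epsilon>: "0 < \<epsilon>"
    and g: "1 \<le> g" "threshold lam \<le> \<alpha> \<Longrightarrow> growth lam \<alpha> \<Gamma> \<le> g"
  shows "\<forall>\<^sub>F n in sequentially. CC_ratio \<alpha> (lambda_Reg lam) \<Gamma> n \<le> ereal (g - 1 + \<epsilon>)"
proof -
  let ?L = "pareto_quantile lam"
  \<comment> \<open>\<mu> lies strictly between \<open>\<alpha> / (g + \<epsilon>)\<close>, the
    approximate supply per buyer of the enlarged market, and \<open>\<alpha> / g\<close>. The lower
    gap pays for concentration via \<delta>, the upper one for a ratio G above \<Gamma>.\<close>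
  define \<mu> where "\<mu> = \<alpha> / (g + \<epsilon> / 2)"
  define \<delta> where "\<delta> = (\<mu> - \<alpha> / (g + \<epsilon>)) / 2"
  have midpoint: "x < y - (y - x) / 2" if "x < y" for x y :: real using that by (simp add: field_simps)
  have "\<alpha> / (g + \<epsilon>) < \<mu>" unfolding \<mu>_def using \<alpha> g \<epsilon> by (intro divide_strict_left_mono) auto
  then have \<delta>: "0 < \<delta>" and \<delta>': "\<alpha> / (g + \<epsilon>) < \<mu> - \<delta>"
    by (simp_all add: \<delta>_def midpoint)
  have \<mu>g: "0 < \<mu>" "\<mu> < \<alpha> / g"
    unfolding \<mu>_def using \<alpha> g \<epsilon> by (auto intro!: divide_strict_left_mono)
  moreover have "\<alpha> / g \<le> \<alpha>" using \<alpha> g by (simp add: field_simps)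
  ultimately have \<mu>: "0 < \<mu>" "\<mu> < \<alpha>" "\<mu> < 1" using \<alpha> by auto
  \<comment> \<open>The surplus of G over \<Gamma> later absorbs the failure probability;
    \<open>G \<le> 1\<close> is required by the certificate.\<close>
  have "\<exists>G. \<Gamma> < G \<and> G \<le> 1 \<and> (\<forall>q. 0 < q \<longrightarrow> q < \<mu> \<longrightarrow> G * (q * ?L q) \<le> \<alpha> * ?L \<mu>)"
  proof (cases "threshold lam \<le> \<alpha>")
    case True
    have growth: "0 < growth lam \<alpha> \<Gamma>" using growth_pos lam \<alpha> \<Gamma> by simp
    have "\<mu> < \<alpha> / growth lam \<alpha> \<Gamma>"
      using \<mu>g(2) divide_left_mono[OF g(2)[OF True], of \<alpha>] growth g \<alpha> by simp
    then have "?L (\<alpha> / growth lam \<alpha> \<Gamma>) < ?L \<mu>"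
      using lam \<mu> by (intro pareto_quantile_strict_antimono) auto
    then have "\<Gamma> * reg_factor lam < \<alpha> * ?L \<mu>"
      using \<alpha> by (subst pareto_quantile_growth[OF lam \<alpha>(1) \<Gamma>(1), symmetric]) simp
    moreover have rf: "0 < reg_factor lam" using lam by (rule reg_factor_pos)
    ultimately have "\<Gamma> < \<alpha> * ?L \<mu> / reg_factor lam" by (simp add: field_simps)
    moreover define G where "G = min 1 (\<alpha> * ?L \<mu> / reg_factor lam)"
    ultimately have G: "\<Gamma> < G" "G \<le> 1" "0 < G" "G \<le> \<alpha> * ?L \<mu> / reg_factor lam"
      using \<Gamma> by auto
    then have "G * reg_factor lam \<le> \<alpha> * ?L \<mu>" using rf by (simp add: pos_le_divide_eq)
    note G = G this
    have "G * (q * ?L q) \<le> \<alpha> * ?L \<mu>" if "0 < q" for q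
      using mult_left_mono[OF pareto_revenue_le[OF lam that], of G] G by linarith
    then show ?thesis using G by blast
  next
    case False
    \<comment> \<open>Below the threshold \<open>q * L q\<close> increases, so even G = 1 is
      possible.\<close>
    have "1 * (q * ?L q) \<le> \<alpha> * ?L \<mu>" if q: "0 < q" "q < \<mu>" for q
    proof -
      have "q * ?L q \<le> \<mu> * ?L \<mu>" using q False \<mu> by (intro pareto_revenue_mono lam) auto
      also have "\<dots> \<le> \<alpha> * ?L \<mu>" using \<mu> lam by (intro mult_right_mono pareto_quantile_nonneg) auto
      finally show ?thesis by simp
    qed
    then show ?thesis using \<Gamma> by blast
  qed
  then obtain G where G: "\<Gamma> < G" "G \<le> 1" and gap: "\<And>q. 0 < q \<Longrightarrow> q < \<mu> \<Longrightarrow> G * (q * ?L q) \<le> \<alpha> * ?L \<mu>"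
    by blast
  have G0: "0 < G" using G \<Gamma> by simp
  have g\<epsilon>: "0 < g + \<epsilon>" using g \<epsilon> by simp
  have "(\<lambda>n. (\<alpha> * real n + 1) / ((g + \<epsilon>) * real n - 1)) \<longlonglongrightarrow> \<alpha> / (g + \<epsilon>)"
    using g\<epsilon> by (real_asymp simp: divide_inverse)
  then have ev1: "\<forall>\<^sub>F n in sequentially. (\<alpha> * real n + 1) / ((g + \<epsilon>) * real n - 1) < \<mu> - \<delta>"
    using \<delta>' by (rule order_tendstoD(2))
  have "(\<lambda>n. G * (1 - exp (- 2 * real n * \<delta>\<^sup>2))) \<longlonglongrightarrow> G * (1 - 0)"
    using \<delta> by (intro tendsto_intros) real_asymp
  then have ev2: "\<forall>\<^sub>F n in sequentially. \<Gamma> < G * (1 - exp (- 2 * real n * \<delta>\<^sup>2))"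
    using G by (intro order_tendstoD(1)) auto
  have ev3: "\<forall>\<^sub>F n in sequentially. 1 < (g + \<epsilon>) * real n"
    using g\<epsilon> by real_asymp
  show ?thesis
    using ev1 ev2 ev3 eventually_gt_at_top[of 0]
  proof eventually_elim
    case (elim n)
    define m where "m = nat \<lceil>\<alpha> * real n\<rceil>"
    define k where "k = nat \<lfloor>(g + \<epsilon> - 1) * real n\<rfloor>"
    have "0 < \<alpha> * real n" using \<alpha> elim by simp
    then have m: "\<alpha> * real n \<le> real m" "real m \<le> \<alpha> * real n + 1" "0 < real m"
      unfolding m_def by linarith+
    have "\<lceil>\<alpha> * real n\<rceil> \<le> int n" using mult_right_mono[OF \<alpha>(2), of "real n"] by (simp add: ceiling_le_iff)
    then have mn: "m \<le> n" unfolding m_def by linarith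
    have "0 \<le> (g + \<epsilon> - 1) * real n" using g \<epsilon> by simp
    then have k: "real k \<le> (g + \<epsilon> - 1) * real n" "(g + \<epsilon> - 1) * real n - 1 \<le> real k"
      unfolding k_def by linarith+
    have N: "(g + \<epsilon>) * real n - 1 \<le> real (n + k)" using k by (simp add: algebra_simps)
    have "real m / real (n + k) \<le> (\<alpha> * real n + 1) / ((g + \<epsilon>) * real n - 1)"
      using m N elim by (intro frac_le) auto
    then have mN: "real m / real (n + k) + \<delta> \<le> \<mu>" using elim by linarith
    then have "real m / real (n + k) < 1" using \<mu> \<delta> by linarith
    then have mk: "m < n + k" using elim by (simp add: field_simps)
    have "ennreal \<Gamma> * Rev_OPT m n F \<le> Rev_VCG m (n + k) F" if F: "F \<in> lambda_Reg lam" for F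
    proof -
      interpret valuation F using F by unfold_locales (simp add: lambda_Reg_def)
      have reg: "lambda_regular lam F" using F by (simp add: lambda_Reg_def)
      \<comment> \<open>The actual supply ratio; m is rounded up, so
        \<open>\<alpha> \<le> a\<close>, and the certificate is applied with a itself.\<close>
      define a where "a = real m / real n"
      have a: "\<alpha> \<le> a" "real n * a = real m" using m elim by (auto simp: a_def field_simps)
      have "\<exists>p c B. 0 \<le> p \<and> 0 \<le> c \<and> 0 \<le> B \<and> \<mu> \<le> S p \<and> (\<forall>x\<ge>c. (x - c) * S x \<le> B) \<and> G * (c * a + B) \<le> a * p"
      proof (rule price_certificate[OF reg lam \<mu>(1) _ \<mu>(3) G0 G(2)])
        fix q assume "0 < q" "q < \<mu>"
        then have "G * (q * ?L q) \<le> \<alpha> * ?L \<mu>" by (rule gap)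
        also have "\<dots> \<le> a * ?L \<mu>" using a \<mu> lam by (intro mult_right_mono pareto_quantile_nonneg) auto
        finally show "G * (q * ?L q) \<le> a * ?L \<mu>" .
      qed (use a \<mu> in simp)
      then obtain p c B where pcB: "0 \<le> p" "0 \<le> c" "0 \<le> B" "\<mu> \<le> S p" "\<forall>x\<ge>c. (x - c) * S x \<le> B"
        and cert: "G * (c * a + B) \<le> a * p" by blast
      let ?E = "1 - exp (- 2 * real (n + k) * \<delta>\<^sup>2)"
      have "Rev_OPT m n F \<le> ennreal (c * real m + real n * B)"
        using pcB m mn by (intro Rev_OPT_upper AE_nonneg) auto
      then have "ennreal \<Gamma> * Rev_OPT m n F \<le> ennreal \<Gamma> * ennreal (c * real m + real n * B)"
        by (intro mult_left_mono) auto
      also have "\<dots> = ennreal (\<Gamma> * (c * real m + real n * B))"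
        using \<Gamma> pcB by (intro ennreal_mult[symmetric]) auto
      also have "\<dots> \<le> ennreal (real m * p * ?E)"
      proof (rule ennreal_leI)
        have "real n * (G * (c * a + B)) \<le> real n * (a * p)" using cert by (intro mult_left_mono) auto
        then have "G * (c * (real n * a) + real n * B) \<le> (real n * a) * p" by (simp add: algebra_simps)
        then have X: "G * (c * real m + real n * B) \<le> real m * p" by (simp only: a)
        have E: "1 - exp (- 2 * real n * \<delta>\<^sup>2) \<le> ?E"
          using exp_decay_antimono[of n k \<delta>] by (rule diff_left_mono)
        have "0 \<le> 1 - exp (- 2 * real n * \<delta>\<^sup>2)" by simp
        then have E0: "0 \<le> ?E" using E by (rule order_trans)
        have "\<Gamma> \<le> G * ?E" using elim mult_left_mono[OF E, of G] G0 by linarith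
        then have "\<Gamma> * (c * real m + real n * B) \<le> (G * ?E) * (c * real m + real n * B)"
          using pcB by (intro mult_right_mono) auto
        also have "\<dots> = (G * (c * real m + real n * B)) * ?E" by simp
        also have "\<dots> \<le> (real m * p) * ?E" using X E0 by (intro mult_right_mono)
        finally show "\<Gamma> * (c * real m + real n * B) \<le> real m * p * ?E" .
      qed
      also have "\<dots> \<le> Rev_VCG m (n + k) F"
        using elim \<delta> pcB mk mN by (intro Rev_VCG_lower) auto
      finally show ?thesis .
    qed
    then have "CC m n (lambda_Reg lam) \<Gamma> \<le> enat k" by (rule CC_le)
    then have "ereal_of_enat (CC m n (lambda_Reg lam) \<Gamma>) \<le> ereal (real k)"
      using ereal_of_enat_le_iff[of "CC m n (lambda_Reg lam) \<Gamma>" "enat k"] by simp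
    then have "CC_ratio \<alpha> (lambda_Reg lam) \<Gamma> n \<le> ereal (real k) / ereal (real n)"
      unfolding CC_ratio_def m_def[symmetric] using elim by (intro ereal_divide_right_mono) auto
    also have "\<dots> = ereal (real k / real n)" using elim by simp
    also have "\<dots> \<le> ereal (g - 1 + \<epsilon>)" using k elim by (simp add: field_simps)
    finally show ?case .
  qed
qed

lemma CC_ratio_lower:
  fixes lam \<alpha> \<Gamma> \<epsilon> :: real
  assumes lam: "0 \<le> lam" "lam \<le> 1" and \<alpha>: "0 < \<alpha>" "\<alpha> \<le> 1" and \<Gamma>: "0 < \<Gamma>" "\<Gamma> < 1"
    and threshold: "threshold lam \<le> \<alpha>" and g: "1 < g" "g < growth lam \<alpha> \<Gamma>"
  shows "\<forall>\<^sub>F n in sequentially. ereal (g - 1) \<le> CC_ratio \<alpha> (lambda_Reg lam) \<Gamma> n"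
proof -
  let ?L = "pareto_quantile lam"
  have growth: "0 < growth lam \<alpha> \<Gamma>" "1 < growth lam \<alpha> \<Gamma>" using g by auto
  have thr: "threshold lam < \<alpha>"
    using threshold_less_if_growth[OF lam \<alpha>(1) threshold \<Gamma> growth(2)] .
  have "\<alpha> / growth lam \<alpha> \<Gamma> < \<alpha> / g"
    using g growth \<alpha> by (intro divide_strict_left_mono) auto
  then have "?L (\<alpha> / g) < ?L (\<alpha> / growth lam \<alpha> \<Gamma>)"
    using lam \<alpha> growth by (intro pareto_quantile_strict_antimono) auto
  then have "\<alpha> * ?L (\<alpha> / g) < \<Gamma> * reg_factor lam"
    using \<alpha> by (subst pareto_quantile_growth[OF lam \<alpha>(1) \<Gamma>(1), symmetric]) simp
  then have "\<alpha> * ?L (\<alpha> / g) / \<Gamma> < reg_factor lam" using \<Gamma> by (simp add: field_simps)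
  \<comment> \<open>Near the threshold the reserve revenue \<open>\<theta> * L \<theta>\<close> is
    so close to its supremum that a market of relative size g still fails the ratio
    \<Gamma>.\<close>
  then obtain \<theta> where \<theta>: "threshold lam < \<theta>" "\<theta> < \<alpha>" "\<alpha> * ?L (\<alpha> / g) / \<Gamma> < \<theta> * ?L \<theta>"
    using pareto_revenue_near_sup[OF lam _ thr] by blast
  have \<theta>0: "0 < \<theta>" using \<theta>(1) threshold_nonneg[of lam] by linarith
  interpret T: truncated_pareto lam \<theta> using lam \<theta> \<alpha> by unfold_locales auto
  interpret T: iid_bids T.truncated by unfold_locales simp
  have cap: "T.cap = ?L \<theta>" by (simp add: T.cap_def)
  have less: "\<alpha> * ?L (\<alpha> / g) < \<Gamma> * (\<theta> * T.cap)" using \<theta>(3) \<Gamma> by (simp add: cap field_simps)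
  \<comment> \<open>The price accepted with probability \<open>\<alpha> / g\<close> lies strictly
    below the cap, so acceptance can be lowered by a small \<delta> without reaching the
    atom.\<close>
  have \<alpha>g: "\<theta> < \<alpha> / g" "\<alpha> / g < \<alpha>"
  proof -
    have "\<Gamma> * (\<theta> * T.cap) \<le> 1 * (\<alpha> * T.cap)"
      using \<Gamma> \<theta> \<theta>0 T.cap_pos by (intro mult_mono) auto
    then have "\<alpha> * ?L (\<alpha> / g) < \<alpha> * ?L \<theta>" using less by (simp add: cap)
    then have "?L (\<alpha> / g) < ?L \<theta>" using \<alpha> by simp
    then show "\<theta> < \<alpha> / g"
      using pareto_quantile_antimono[OF lam(1), of "\<alpha> / g" \<theta>] \<alpha> g by (cases "\<theta> < \<alpha> / g") auto
    show "\<alpha> / g < \<alpha>" using \<alpha> g by (simp add: field_simps)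
  qed
  have cont: "isCont ?L (\<alpha> / g)"
  proof -
    have "isCont (\<lambda>q. q * ?L q / q) (\<alpha> / g)"
      using \<alpha> g by (intro continuous_divide DERIV_isCont[OF pareto_revenue_deriv]) auto
    moreover have "\<forall>\<^sub>F q in nhds (\<alpha> / g). q \<in> {0<..}"
      using \<alpha> g by (intro eventually_nhds_in_open) auto
    then have "\<forall>\<^sub>F q in nhds (\<alpha> / g). q * ?L q / q = ?L q"
      by eventually_elim simp
    ultimately show ?thesis by (rule isCont_cong[THEN iffD1, rotated])
  qed
  have lim_sub: "((\<lambda>d. \<alpha> / g - d) \<longlongrightarrow> \<alpha> / g - 0) (at_right 0)" by (intro tendsto_intros)
  have "((\<lambda>d. \<alpha> * ?L (\<alpha> / g - d)) \<longlongrightarrow> \<alpha> * ?L (\<alpha> / g)) (at_right 0)"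
    using isCont_tendsto_compose[OF cont, of "\<lambda>d. \<alpha> / g - d"] lim_sub by (intro tendsto_intros) simp
  moreover have "((\<lambda>d. \<Gamma> * ((\<theta> - d) * T.cap)) \<longlongrightarrow> \<Gamma> * ((\<theta> - 0) * T.cap)) (at_right 0)"
    by (intro tendsto_intros)
  ultimately have "((\<lambda>d. \<Gamma> * ((\<theta> - d) * T.cap) - \<alpha> * ?L (\<alpha> / g - d)) \<longlongrightarrow> \<Gamma> * ((\<theta> - 0) * T.cap) - \<alpha> * ?L (\<alpha> / g)) (at_right 0)"
    by (rule tendsto_diff[rotated])
  then have "\<forall>\<^sub>F d in at_right 0. 0 < \<Gamma> * ((\<theta> - d) * T.cap) - \<alpha> * ?L (\<alpha> / g - d)"
    using less by (intro order_tendstoD(1)) auto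
  moreover have "\<forall>\<^sub>F d in at_right 0. \<theta> < \<alpha> / g - d"
    using \<alpha>g by (intro order_tendstoD(1)[OF lim_sub]) auto
  moreover have "\<forall>\<^sub>F d in at_right 0. d \<in> {0<..<\<theta>}" using \<theta>0 by (rule eventually_at_right_real)
  ultimately have "\<forall>\<^sub>F d in at_right 0. 0 < \<Gamma> * ((\<theta> - d) * T.cap) - \<alpha> * ?L (\<alpha> / g - d) \<and> \<theta> < \<alpha> / g - d \<and> d \<in> {0<..<\<theta>}"
    by eventually_elim simp
  then obtain \<delta> where "0 < \<Gamma> * ((\<theta> - \<delta>) * T.cap) - \<alpha> * ?L (\<alpha> / g - \<delta>) \<and> \<theta> < \<alpha> / g - \<delta> \<and> \<delta> \<in> {0<..<\<theta>}"
    using eventually_happens'[OF trivial_limit_at_right_real] by blast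
  then have \<delta>: "0 < \<delta>" "\<delta> < \<theta>" "\<theta> < \<alpha> / g - \<delta>" "\<alpha> * ?L (\<alpha> / g - \<delta>) < \<Gamma> * ((\<theta> - \<delta>) * T.cap)"
    by simp_all
  define \<sigma> where "\<sigma> = \<alpha> / g - \<delta>"
  define p where "p = ?L \<sigma>"
  have \<sigma>: "\<theta> < \<sigma>" "\<sigma> < 1" using \<delta> \<alpha>g \<alpha> by (auto simp: \<sigma>_def)
  have p: "0 \<le> p" "T.prob {p..} = \<sigma>"
    using \<sigma> \<theta>0 lam by (auto simp: p_def intro!: T.prob_quantile pareto_quantile_nonneg)
  \<comment> \<open>Per original buyer, A bounds the VCG revenue from above and B bounds \<Gamma>
    times the optimal revenue from below; the +1 and -1 account for rounding m and K. Their limits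
    are strictly ordered by the choice of \<delta>.\<close>
  define A where "A n = (\<alpha> * real n + 1) * (p + T.cap * exp (- 2 * real n * \<delta>\<^sup>2)) / real n" for n
  define B where "B n = \<Gamma> * (T.cap * (real n * (\<theta> - \<delta>) - 1) * (1 - exp (- 2 * real n * \<delta>\<^sup>2))) / real n" for n
  have exp_lim: "(\<lambda>n. exp (- 2 * real n * \<delta>\<^sup>2)) \<longlonglongrightarrow> 0" using \<delta>(1) by real_asymp
  have inv_lim: "(\<lambda>n. 1 / real n) \<longlonglongrightarrow> 0" by real_asymp
  have "(\<lambda>n. (\<alpha> + 1 / real n) * (p + T.cap * exp (- 2 * real n * \<delta>\<^sup>2))) \<longlonglongrightarrow> (\<alpha> + 0) * (p + T.cap * 0)"
    by (intro tendsto_intros exp_lim inv_lim)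
  moreover have "\<forall>\<^sub>F n in sequentially. (\<alpha> + 1 / real n) * (p + T.cap * exp (- 2 * real n * \<delta>\<^sup>2)) = A n"
    using eventually_gt_at_top[of 0] by eventually_elim (simp add: A_def add_divide_distrib distrib_right)
  ultimately have A: "A \<longlonglongrightarrow> (\<alpha> + 0) * (p + T.cap * 0)" by (rule Lim_transform_eventually)
  have "(\<lambda>n. \<Gamma> * (T.cap * ((\<theta> - \<delta>) - 1 / real n) * (1 - exp (- 2 * real n * \<delta>\<^sup>2)))) \<longlonglongrightarrow> \<Gamma> * (T.cap * ((\<theta> - \<delta>) - 0) * (1 - 0))"
    by (intro tendsto_intros exp_lim inv_lim)
  moreover have "\<forall>\<^sub>F n in sequentially. \<Gamma> * (T.cap * ((\<theta> - \<delta>) - 1 / real n) * (1 - exp (- 2 * real n * \<delta>\<^sup>2))) = B n"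
    using eventually_gt_at_top[of 0]
  proof eventually_elim
    case (elim n)
    have "(\<theta> - \<delta>) - 1 / real n = (real n * (\<theta> - \<delta>) - 1) / real n" using elim by (simp add: diff_divide_distrib)
    then show ?case by (simp only: B_def times_divide_eq_right times_divide_eq_left)
  qed
  ultimately have B: "B \<longlonglongrightarrow> \<Gamma> * (T.cap * ((\<theta> - \<delta>) - 0) * (1 - 0))" by (rule Lim_transform_eventually)
  have "(\<lambda>n. B n - A n) \<longlonglongrightarrow> \<Gamma> * (T.cap * ((\<theta> - \<delta>) - 0) * (1 - 0)) - (\<alpha> + 0) * (p + T.cap * 0)"
    by (intro tendsto_diff A B)
  then have ev1: "\<forall>\<^sub>F n in sequentially. 0 < B n - A n"
    using \<delta>(4) by (intro order_tendstoD(1)) (auto simp: p_def \<sigma>_def mult_ac)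
  have ev2: "\<forall>\<^sub>F n in sequentially. 1 < real n * (\<theta> - \<delta>)"
    using \<delta>(2) by real_asymp
  show ?thesis
    using ev1 ev2 eventually_gt_at_top[of 0]
  proof eventually_elim
    case (elim n)
    define m where "m = nat \<lceil>\<alpha> * real n\<rceil>"
    define K where "K = nat \<lfloor>real n * (\<theta> - \<delta>)\<rfloor>"
    have "0 < \<alpha> * real n" using \<alpha> elim by simp
    then have m: "\<alpha> * real n \<le> real m" "real m \<le> \<alpha> * real n + 1" "0 < real m"
      unfolding m_def by linarith+
    have "\<lceil>\<alpha> * real n\<rceil> \<le> int n" using mult_right_mono[OF \<alpha>(2), of "real n"] by (simp add: ceiling_le_iff)
    then have mn: "m \<le> n" unfolding m_def by linarith
    have K: "real K \<le> real n * (\<theta> - \<delta>)" "real n * (\<theta> - \<delta>) - 1 \<le> real K"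
      using elim unfolding K_def by linarith+
    have "real n * (\<theta> - \<delta>) \<le> real n * \<alpha>" using \<theta> \<delta> by (intro mult_left_mono) auto
    then have Km: "K \<le> m" using K m by (simp add: mult.commute)
    have exp1: "0 \<le> 1 - exp (- 2 * real n * \<delta>\<^sup>2)" by simp
    have "g * real n - real n \<le> real k"
      if all: "\<And>F. F \<in> lambda_Reg lam \<Longrightarrow> ennreal \<Gamma> * Rev_OPT m n F \<le> Rev_VCG m (n + k) F" for k
    proof (rule ccontr)
      assume "\<not> g * real n - real n \<le> real k"
      then have N: "real (n + k) < g * real n" by simp
      have "\<alpha> / g = \<alpha> * real n / (g * real n)" using elim by simp
      also have "\<dots> \<le> real m / real (n + k)" using m N elim \<alpha> by (intro frac_le) auto
      finally have demand: "T.prob {p..} + \<delta> \<le> real m / real (n + k)" by (simp add: p \<sigma>_def)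
      have "ennreal (\<Gamma> * (T.cap * real K * (1 - exp (- 2 * real n * \<delta>\<^sup>2)))) = ennreal \<Gamma> * ennreal (T.cap * real K * (1 - exp (- 2 * real n * \<delta>\<^sup>2)))"
        using \<Gamma> T.cap_pos by (intro ennreal_mult) auto
      also have "\<dots> \<le> ennreal \<Gamma> * Rev_OPT m n T.truncated"
        using T.Rev_OPT_lower[of n m \<delta> K] elim mn \<delta> Km K T.cap_pos T.prob_atLeast[of T.cap]
        by (intro mult_left_mono) (auto simp: T.monopoly_reserve_truncated T.survival_cap)
      also have "\<dots> \<le> Rev_VCG m (n + k) T.truncated" by (rule all[OF T.truncated_in_lambda_Reg])
      also have "\<dots> \<le> ennreal (real m * (p + T.cap * exp (- 2 * real (n + k) * \<delta>\<^sup>2)))"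
        using elim mn \<delta> p T.cap_pos T.truncated_le_cap demand by (intro T.Rev_VCG_upper) auto
      finally have "\<Gamma> * (T.cap * real K * (1 - exp (- 2 * real n * \<delta>\<^sup>2))) \<le> real m * (p + T.cap * exp (- 2 * real (n + k) * \<delta>\<^sup>2))"
        using p T.cap_pos by (subst (asm) ennreal_le_iff) auto
      also have "\<dots> \<le> (\<alpha> * real n + 1) * (p + T.cap * exp (- 2 * real n * \<delta>\<^sup>2))"
        using m p T.cap_pos \<alpha> by (intro mult_mono add_mono mult_left_mono exp_decay_antimono) auto
      also have "\<dots> = real n * A n" using elim by (simp add: A_def)
      finally have "\<Gamma> * (T.cap * real K * (1 - exp (- 2 * real n * \<delta>\<^sup>2))) \<le> real n * A n" .
      moreover have "real n * B n \<le> \<Gamma> * (T.cap * real K * (1 - exp (- 2 * real n * \<delta>\<^sup>2)))"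
      proof -
        have "real n * B n = \<Gamma> * (T.cap * (real n * (\<theta> - \<delta>) - 1) * (1 - exp (- 2 * real n * \<delta>\<^sup>2)))"
          using elim by (simp add: B_def)
        also have "\<dots> \<le> \<Gamma> * (T.cap * real K * (1 - exp (- 2 * real n * \<delta>\<^sup>2)))"
          using K \<Gamma> T.cap_pos exp1 by (intro mult_left_mono mult_right_mono) auto
        finally show ?thesis .
      qed
      ultimately have "real n * B n \<le> real n * A n" by linarith
      then show False using elim by simp
    qed
    then have "ereal (g * real n - real n) \<le> ereal_of_enat (CC m n (lambda_Reg lam) \<Gamma>)"
      by (rule CC_ge)
    then have "ereal (g * real n - real n) / ereal (real n) \<le> CC_ratio \<alpha> (lambda_Reg lam) \<Gamma> n"
      unfolding CC_ratio_def m_def[symmetric] using elim by (intro ereal_divide_right_mono) auto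
    also have "ereal (g * real n - real n) / ereal (real n) = ereal (g - 1)"
      using elim by (simp add: field_simps)
    finally show ?case .
  qed
qed

lemma CC_ratio_nonneg: "0 \<le> CC_ratio \<alpha> \<F> \<Gamma> n"
proof (cases "n = 0")
  case False
  then show ?thesis unfolding CC_ratio_def by (intro zero_le_divide_ereal) auto
qed (simp add: CC_ratio_def ereal_divide)

lemma tendsto_ereal_squeeze:
  fixes f :: "nat \<Rightarrow> ereal"
  assumes "\<And>\<epsilon>. 0 < \<epsilon> \<Longrightarrow> \<forall>\<^sub>F n in sequentially. ereal (x - \<epsilon>) \<le> f n"
    and "\<And>\<epsilon>. 0 < \<epsilon> \<Longrightarrow> \<forall>\<^sub>F n in sequentially. f n \<le> ereal (x + \<epsilon>)"
  shows "f \<longlonglongrightarrow> ereal x"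
proof (rule order_tendstoI)
  fix l assume "l < ereal x"
  then obtain y where y: "l < ereal y" "y < x" using ereal_dense2[of l "ereal x"] by auto
  show "\<forall>\<^sub>F n in sequentially. l < f n"
    using assms(1)[of "x - y"] y by (auto elim!: eventually_mono)
next
  fix u assume "ereal x < u"
  then obtain y where y: "x < y" "ereal y < u" using ereal_dense2[of "ereal x" u] by auto
  show "\<forall>\<^sub>F n in sequentially. f n < u"
    using assms(2)[of "y - x"] y by (auto elim!: eventually_mono)
qed

lemma CC_ratio_tendsto:
  assumes lam: "0 \<le> lam" "lam \<le> 1" and \<alpha>: "0 < \<alpha>" "\<alpha> \<le> 1" and \<Gamma>: "0 < \<Gamma>" "\<Gamma> < 1"
  shows "CC_ratio \<alpha> (lambda_Reg lam) \<Gamma> \<longlonglongrightarrow>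
    ereal (max (growth lam \<alpha> \<Gamma> - 1) 0 * (if threshold lam \<le> \<alpha> then 1 else 0))" (is "_ \<longlonglongrightarrow> ereal ?x")
proof (rule tendsto_ereal_squeeze)
  fix \<epsilon> :: real assume \<epsilon>: "0 < \<epsilon>"
  \<comment> \<open>The choice g = \<open>?x + 1\<close> is 1 for \<alpha> below the threshold and
    \<open>max (growth lam \<alpha> \<Gamma>) 1\<close> otherwise.\<close>
  show "\<forall>\<^sub>F n in sequentially. CC_ratio \<alpha> (lambda_Reg lam) \<Gamma> n \<le> ereal (?x + \<epsilon>)"
    using CC_ratio_upper[OF lam \<alpha> \<Gamma> \<epsilon>, of "?x + 1"] by auto
  \<comment> \<open>A non-positive bound is trivial; a positive one forces \<alpha> to reach the
    threshold and \<open>growth\<close> to exceed 1.\<close>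
  show "\<forall>\<^sub>F n in sequentially. ereal (?x - \<epsilon>) \<le> CC_ratio \<alpha> (lambda_Reg lam) \<Gamma> n"
  proof (cases "0 < ?x - \<epsilon>")
    case True
    then have "threshold lam \<le> \<alpha>" "?x = growth lam \<alpha> \<Gamma> - 1"
      using \<epsilon> by (auto split: if_splits simp: max_def)
    then show ?thesis using CC_ratio_lower[OF lam \<alpha> \<Gamma>, of "growth lam \<alpha> \<Gamma> - \<epsilon>"] True \<epsilon> by (simp add: algebra_simps)
  next
    case False
    then have "ereal (?x - \<epsilon>) \<le> ereal 0" by (simp only: ereal_less_eq not_less)
    then have "ereal (?x - \<epsilon>) \<le> 0" by (simp only: zero_ereal_def)
    then show ?thesis using CC_ratio_nonneg order_trans by (intro always_eventually allI) blast
  qed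
qed

theorem theorem4p2:
  fixes lam \<alpha> \<Gamma> :: real
  assumes "0 \<le> lam" and "lam \<le> 1"
    and "0 < \<alpha>" and "\<alpha> \<le> 1"
    and "0 < \<Gamma>" and "\<Gamma> < 1"
  shows
    "convergent (CC_ratio \<alpha> (lambda_Reg lam) \<Gamma>) \<and>
     CC_infty \<alpha> (lambda_Reg lam) \<Gamma>
       = ereal (max (growth lam \<alpha> \<Gamma> - 1) 0 * (if threshold lam \<le> \<alpha> then 1 else 0)) \<and>
     CC_infty \<alpha> MHR \<Gamma>
       = ereal (max (\<alpha> * exp (\<Gamma> / (exp 1 * \<alpha>)) - 1) 0 * (if 1 / exp 1 \<le> \<alpha> then 1 else 0)) \<and>
     CC_infty \<alpha> Reg \<Gamma> = ereal (max (\<Gamma> + \<alpha> - 1) 0)"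
proof -
  have lim: "CC_infty \<alpha> (lambda_Reg l) \<Gamma> = ereal (max (growth l \<alpha> \<Gamma> - 1) 0 * (if threshold l \<le> \<alpha> then 1 else 0))"
    if "0 \<le> l" "l \<le> 1" for l
    unfolding CC_infty_def using CC_ratio_tendsto[OF that assms(3-6)] by (rule limI)
  have "growth 1 \<alpha> \<Gamma> = \<Gamma> + \<alpha>" "threshold 1 = 0"
    using assms by (simp_all add: growth_def reg_factor_def threshold_def field_simps)
  then have "CC_infty \<alpha> Reg \<Gamma> = ereal (max (\<Gamma> + \<alpha> - 1) 0)"
    using lim[of 1] assms by simp
  moreover have "growth 0 \<alpha> \<Gamma> = \<alpha> * exp (\<Gamma> / (exp 1 * \<alpha>))" "threshold 0 = 1 / exp 1"
    by (simp_all add: growth_def threshold_def exp_minus inverse_eq_divide)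
  then have "CC_infty \<alpha> MHR \<Gamma>
       = ereal (max (\<alpha> * exp (\<Gamma> / (exp 1 * \<alpha>)) - 1) 0 * (if 1 / exp 1 \<le> \<alpha> then 1 else 0))"
    using lim[of 0] by simp
  moreover have "convergent (CC_ratio \<alpha> (lambda_Reg lam) \<Gamma>)"
    using CC_ratio_tendsto[OF assms] by (rule convergentI)
  ultimately show ?thesis using lim[OF assms(1,2)] by blast
qed

end
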